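(* Let $(\mathbf{Q},\mathcal{E}_\varepsilon,\mathcal{R}_\varepsilon)_{\varepsilon>0}$ be a family of gradient systems. (i) If the family converges in the sense of EDP convergence with tilting (tilt-EDP convergence) with limiting dissipation potential $\widehat{\mathcal{R}}_0$, then it converges in the sense of contact EDP convergence with tilting (contact-EDP convergence) with $\mathcal{R}_{\mathrm{eff}}=\widehat{\mathcal{R}}_0$. (ii) If the family converges in the sense of contact-EDP convergence with limiting dissipation potential $\mathcal{R}_{\mathrm{eff}}$, and $\mathcal{R}_{\mathrm{eff}}(q,\cdot)$ is superlinear for all $q\in\mathbf{Q}$, then it converges in the simple EDP sense. (iii) In addition, if tilt-EDP convergence holds, then all three convergences (tilt-EDP, contact-EDP, simple EDP) hold and the limiting dissipation potentials coincide: $\widehat{\mathcal{R}}_0=\mathcal{R}_{\mathrm{eff}}=\widetilde{\mathcal{R}}_0$, where $\widetilde{\mathcal{R}}_0$ is the limiting dissipation potential for simple EDP convergence.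
   Context: Gradient systems. A gradient system is a triple $(\mathbf{Q},\mathcal{E},\mathcal{R})$ where $\mathbf{Q}$ is a smooth finite-dimensional Riemannian manifold, $\mathcal{E}:\mathbf{Q}\to\mathbb{R}$ is continuously differentiable, and $\mathcal{R}:T\mathbf{Q}\to[0,\infty]$ is a dissipation potential: for each $q$, $\mathcal{R}(q,\cdot):T_q\mathbf{Q}\to[0,\infty]$ is convex and lower semicontinuous and $\mathcal{R}(q,0)=\min_v\mathcal{R}(q,v)=0$. Its dual is $\mathcal{R}^*(q,\xi)=\sup_{v\in T_q\mathbf{Q}}\langle\xi,v\rangle-\mathcal{R}(q,v)$. $\mathcal{R}(q,\cdot)$ is superlinear if $\lim_{|v|\to\infty}|v|^{-1}\mathcal{R}(q,v)=+\infty$. $T\mathbf{Q}\oplus T^*\mathbf{Q}$ is the set of triples $(q,v,\xi)$ with $q\in\mathbf{Q}$, $v\in T_q\mathbf{Q}$, $\xi\in T_q^*\mathbf{Q}$. All limits and $\Gamma$-limits are for $\varepsilon\to0$. $\mathrm{D}$ denotes the differential. Dissipation functionals. For $T>0$, $\mathcal{F}\in C^1(\mathbf{Q};\mathbb{R})$ and $q\in \mathrm{AC}([0,T];\mathbf{Q})$ put $$\mathfrak{D}_\varepsilon^T(q,\mathcal{F})=\int_0^T\Big[\mathcal{R}_\varepsilon(q,\dot q)+\mathcal{R}_\varepsilon^*\big(q,-\mathrm{D}\mathcal{E}_\varepsilon(q)-\mathrm{D}\mathcal{F}(q)\big)\Big]\mathrm{d}t,\qquad \mathfrak{D}_\varepsilon^T(q)=\mathfrak{D}_\varepsilon^T(q,0).$$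 For $\Gamma$-convergence in $C([0,T];\mathbf{Q})$ these functionals, and their limits, are understood as $+\infty$ on curves that are not absolutely continuous. Simple EDP convergence. $(\mathbf{Q},\mathcal{E}_\varepsilon,\mathcal{R}_\varepsilon)$ converges in the simple EDP sense to a gradient system $(\mathbf{Q},\mathcal{E}_0,\widetilde{\mathcal{R}}_0)$ if $\mathcal{E}_\varepsilon$ $\Gamma$-converges to $\mathcal{E}_0$ in $\mathbf{Q}$ and, for each $T>0$, $\mathfrak{D}_\varepsilon^T$ $\Gamma$-converges in $C([0,T];\mathbf{Q})$ to $\mathfrak{D}_0^T(q)=\int_0^T[\widetilde{\mathcal{R}}_0(q,\dot q)+\widetilde{\mathcal{R}}_0^*(q,-\mathrm{D}\mathcal{E}_0(q))]\,\mathrm{d}t$. Basic assumptions. A family $(\mathbf{Q},\mathcal{E}_\varepsilon,\mathcal{R}_\varepsilon)$ satisfies the basic assumptions if: (1) $\mathcal{E}_\varepsilon$ $\Gamma$-converges to $\mathcal{E}_0$ in $\mathbf{Q}$. (2) For all $T>0$ there is a functional $\mathfrak{D}_0^T:\mathrm{AC}([0,T];\mathbf{Q})\times C^1(\mathbf{Q};\mathbb{R})\to[0,\infty]$ such that, for each $\mathcal{F}\in C^1(\mathbf{Q};\mathbb{R})$, $\mathfrak{D}_\varepsilon^T(\cdot,\mathcal{F})$ $\Gamma$-converges to $\mathfrak{D}_0^T(\cdot,\mathcal{F})$ in the topology of $C([0,T];\mathbf{Q})$. (3) There is a function $\mathcal{N}_0:T\mathbf{Q}\oplus T^*\mathbf{Q}\to[0,\infty]$,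 independent of $T$, such that $\mathfrak{D}_0^T(q,\mathcal{F})=\int_0^T\mathcal{N}_0(q(t),\dot q(t),-\mathrm{D}\mathcal{F}(q(t)))\,\mathrm{d}t$ for all $\mathcal{F}\in C^1(\mathbf{Q};\mathbb{R})$; and for all $(q,\eta)\in T^*\mathbf{Q}$ the map $v\mapsto\mathcal{N}_0(q,v,\eta)$ is convex and lower semicontinuous. Define $\mathcal{M}_0(q,v,\xi)=\mathcal{N}_0(q,v,\xi+\mathrm{D}\mathcal{E}_0(q))$. (4) $\mathcal{M}_0(q,v,\xi)\ge\langle\xi,v\rangle$ for all $(q,v,\xi)\in T\mathbf{Q}\oplus T^*\mathbf{Q}$. (5) $\mathcal{M}_0(q,v,\xi)\ge\mathcal{M}_0(q,0,\xi)$ for all $(q,v,\xi)\in T\mathbf{Q}\oplus T^*\mathbf{Q}$. EDP convergence with tilting (tilt-EDP convergence) to a gradient system $(\mathbf{Q},\mathcal{E}_0,\widehat{\mathcal{R}}_0)$ means: the family satisfies the basic assumptions and, for all $q\in\mathbf{Q}$, $\mathcal{M}_0(q,v,\xi)=\widehat{\mathcal{R}}_0(q,v)+\widehat{\mathcal{R}}_0^*(q,\xi)$ for all $v,\xi$, where $\widehat{\mathcal{R}}_0$ is a dissipation potential. Contact EDP convergence with tilting (contact-EDP convergence) to a gradient system $(\mathbf{Q},\mathcal{E}_0,\mathcal{R}_{\mathrm{eff}})$ means: the family satisfies the basic assumptions and, for all $q\in\mathbf{Q}$, $\{(v,\xi):\mathcal{M}_0(q,v,\xi)=\langle\xi,v\rangle\}=\mathrm{graph}(\partial_v\mathcal{R}_{\mathrm{eff}}(q,\cdot))$,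 where $\mathcal{R}_{\mathrm{eff}}$ is a dissipation potential and $\partial_v$ is the convex subdifferential in $v$. *)

theory Defs
  imports "HOL-Analysis.Analysis"
begin

section \<open>Smooth Riemannian manifolds\<close>

text \<open>
  The points of a manifold form a Hausdorff, second countable type \<open>'q\<close>. The model space is a type
  \<open>'m\<close> of sort \<open>{real_inner, heine_borel}\<close>, that is, a finite-dimensional Euclidean space; unlike
  \<open>euclidean_space\<close> this sort does not exclude dimension 0. A chart is a pair of its
  domain and its coordinate map; values of the coordinate map outside the domain are irrelevant.
\<close>

type_synonym ('q, 'm) chart = "'q set \<times> ('q \<Rightarrow> 'm)"

abbreviation chart_dom :: "('q, 'm) chart \<Rightarrow> 'q set" where
  "chart_dom c \<equiv> fst c"

abbreviation chart_map :: "('q, 'm) chart \<Rightarrow> 'q \<Rightarrow> 'm" where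
  "chart_map c \<equiv> snd c"

definition chart_inv :: "('q, 'm) chart \<Rightarrow> 'm \<Rightarrow> 'q" where
  "chart_inv c = inv_into (chart_dom c) (chart_map c)"

definition is_chart :: "('q::topological_space, 'm::real_normed_vector) chart \<Rightarrow> bool" where
  "is_chart c \<longleftrightarrow> open (chart_dom c) \<and> open (chart_map c ` chart_dom c) \<and>
     homeomorphism (chart_dom c) (chart_map c ` chart_dom c) (chart_map c) (chart_inv c)"

text \<open>
  \<open>Ck_on k f S\<close> is k-fold continuous differentiability on an open set: on a finite-dimensional
  space it suffices to differentiate all directional derivatives.
\<close>

primrec Ck_on :: "nat \<Rightarrow> ('a::real_normed_vector \<Rightarrow> 'b::real_normed_vector) \<Rightarrow> 'a set \<Rightarrow> bool" where
  "Ck_on 0 f S \<longleftrightarrow> continuous_on S f"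
| "Ck_on (Suc k) f S \<longleftrightarrow> (\<forall>x\<in>S. f differentiable (at x)) \<and>
     (\<forall>w. Ck_on k (\<lambda>x. frechet_derivative f (at x) w) S)"

definition smooth_on :: "('a::real_normed_vector \<Rightarrow> 'b::real_normed_vector) \<Rightarrow> 'a set \<Rightarrow> bool" where
  "smooth_on f S \<longleftrightarrow> (\<forall>k. Ck_on k f S)"

definition smooth_atlas ::
  "('q::topological_space, 'm::real_normed_vector) chart set \<Rightarrow> bool" where
  "smooth_atlas A \<longleftrightarrow> (\<forall>c\<in>A. is_chart c) \<and> (\<Union>c\<in>A. chart_dom c) = UNIV \<and>
     (\<forall>c\<in>A. \<forall>d\<in>A. smooth_on (chart_map d \<circ> chart_inv c)
        (chart_map c ` (chart_dom c \<inter> chart_dom d)))"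

text \<open>
  The tangent space at \<open>q\<close> is \<open>'m\<close>, a tangent vector being represented by its coordinates in one
  chosen chart \<open>chart_at A q\<close> around \<open>q\<close>; the cotangent space at \<open>q\<close> is accordingly the dual
  \<open>'m \<Rightarrow>\<^sub>L real\<close>, with pairing \<open>blinfun_apply \<xi> v\<close>. So functions on the tangent bundle have type
  \<open>'q \<Rightarrow> 'm \<Rightarrow> _\<close>. Since the chosen chart depends on \<open>q\<close> in an arbitrary manner, regularity in
  \<open>q\<close> must always be expressed through \<open>coord_change\<close>, which converts the coordinates of
  a tangent vector at \<open>q\<close> from a chart \<open>c\<close> to the chosen one.
\<close>

definition chart_at :: "('q, 'm) chart set \<Rightarrow> 'q \<Rightarrow> ('q, 'm) chart" where
  "chart_at A q = (SOME c. c \<in> A \<and> q \<in> chart_dom c)"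

definition coord_change ::
  "('q, 'm::real_normed_vector) chart set \<Rightarrow> ('q, 'm) chart \<Rightarrow> 'q \<Rightarrow> 'm \<Rightarrow> 'm" where
  "coord_change A c q =
     frechet_derivative (chart_map (chart_at A q) \<circ> chart_inv c) (at (chart_map c q))"

definition riemannian_metric ::
  "('q::topological_space, 'm::real_normed_vector) chart set \<Rightarrow> ('q \<Rightarrow> 'm \<Rightarrow> 'm \<Rightarrow> real) \<Rightarrow> bool" where
  "riemannian_metric A g \<longleftrightarrow>
     (\<forall>q. bounded_bilinear (g q) \<and> (\<forall>v w. g q v w = g q w v) \<and> (\<forall>v. v \<noteq> 0 \<longrightarrow> 0 < g q v v)) \<and>
     (\<forall>c\<in>A. \<forall>v w. smooth_on
        (\<lambda>x. let q = chart_inv c x in g q (coord_change A c q v) (coord_change A c q w))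
        (chart_map c ` chart_dom c))"

definition riemannian_manifold ::
  "('q::{t2_space, second_countable_topology}, 'm::{real_inner, heine_borel}) chart set \<Rightarrow>
   ('q \<Rightarrow> 'm \<Rightarrow> 'm \<Rightarrow> real) \<Rightarrow> bool" where
  "riemannian_manifold A g \<longleftrightarrow> smooth_atlas A \<and> riemannian_metric A g"

definition riem_norm :: "('q \<Rightarrow> 'm \<Rightarrow> 'm \<Rightarrow> real) \<Rightarrow> 'q \<Rightarrow> 'm \<Rightarrow> real" where
  "riem_norm g q v = sqrt (g q v v)"

definition C1_function ::
  "('q, 'm::real_normed_vector) chart set \<Rightarrow> ('q \<Rightarrow> real) \<Rightarrow> bool" where
  "C1_function A F \<longleftrightarrow> (\<forall>c\<in>A. Ck_on 1 (F \<circ> chart_inv c) (chart_map c ` chart_dom c))"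

definition differential ::
  "('q, 'm::real_normed_vector) chart set \<Rightarrow> ('q \<Rightarrow> real) \<Rightarrow> 'q \<Rightarrow> 'm \<Rightarrow>\<^sub>L real" where
  "differential A F q = (let c = chart_at A q in
     Blinfun (frechet_derivative (F \<circ> chart_inv c) (at (chart_map c q))))"

section \<open>Absolutely continuous curves\<close>

text \<open>
  A curve on \<open>{0..T}\<close> is a total function of which only the values on \<open>{0..T}\<close> matter.
\<close>

definition abs_continuous_on :: "real \<Rightarrow> real \<Rightarrow> (real \<Rightarrow> 'm::real_normed_vector) \<Rightarrow> bool" where
  "abs_continuous_on a b f \<longleftrightarrow>
     (\<forall>e>0. \<exists>d>0. \<forall>(n::nat) s t.
        (\<forall>i<n. a \<le> s i \<and> s i \<le> t i \<and> t i \<le> b) \<and>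
        (\<forall>i<n. \<forall>j<n. i \<noteq> j \<longrightarrow> {s i<..<t i} \<inter> {s j<..<t j} = {}) \<and>
        (\<Sum>i<n. t i - s i) < d
        \<longrightarrow> (\<Sum>i<n. norm (f (t i) - f (s i))) < e)"

definition AC_curve ::
  "('q::topological_space, 'm::real_normed_vector) chart set \<Rightarrow> real \<Rightarrow> (real \<Rightarrow> 'q) \<Rightarrow> bool" where
  "AC_curve A T u \<longleftrightarrow> continuous_on {0..T} u \<and>
     (\<forall>c\<in>A. \<forall>a b. 0 \<le> a \<and> a \<le> b \<and> b \<le> T \<and> u ` {a..b} \<subseteq> chart_dom c
        \<longrightarrow> abs_continuous_on a b (chart_map c \<circ> u))"

text \<open>
  The velocity at \<open>t\<close>, in the coordinates of the chosen chart at \<open>u t\<close>. For an absolutely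
  continuous curve it is meaningful for almost every \<open>t\<close>.
\<close>

definition velocity ::
  "('q, 'm::real_normed_vector) chart set \<Rightarrow> real \<Rightarrow> (real \<Rightarrow> 'q) \<Rightarrow> real \<Rightarrow> 'm" where
  "velocity A T u t = vector_derivative (chart_map (chart_at A (u t)) \<circ> u) (at t within {0..T})"

text \<open>
  The space of continuous curves on \<open>{0..T}\<close> carries the compact-open topology, i.e. the topology
  of uniform convergence for any metric inducing the topology of the manifold.
\<close>

definition curve_topology :: "real \<Rightarrow> (real \<Rightarrow> 'q::topological_space) topology" where
  "curve_topology T = subtopology
     (topology_generated_by {{u. u ` K \<subseteq> U} | K U. compact K \<and> K \<subseteq> {0..T} \<and> open U})
     {u. continuous_on {0..T} u}"

section \<open>Gamma-convergence as \<open>\<epsilon> \<rightarrow> 0\<close>\<close>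

text \<open>
  The sequential characterization, appropriate to the first countable topologies used here.
\<close>

definition Gamma_converges ::
  "'x topology \<Rightarrow> (real \<Rightarrow> 'x \<Rightarrow> 'v::complete_lattice) \<Rightarrow> ('x \<Rightarrow> 'v) \<Rightarrow> bool" where
  "Gamma_converges X \<Phi> \<Phi>0 \<longleftrightarrow> (\<forall>x\<in>topspace X.
     (\<forall>y. limitin X y x (at_right 0) \<longrightarrow> \<Phi>0 x \<le> Liminf (at_right 0) (\<lambda>\<epsilon>. \<Phi> \<epsilon> (y \<epsilon>))) \<and>
     (\<exists>y. limitin X y x (at_right 0) \<and> Limsup (at_right 0) (\<lambda>\<epsilon>. \<Phi> \<epsilon> (y \<epsilon>)) \<le> \<Phi>0 x))"

definition Gamma_converges_energy ::
  "(real \<Rightarrow> 'q::topological_space \<Rightarrow> real) \<Rightarrow> ('q \<Rightarrow> real) \<Rightarrow> bool" where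
  "Gamma_converges_energy E E0 \<longleftrightarrow>
     Gamma_converges euclidean (\<lambda>\<epsilon> q. ereal (E \<epsilon> q)) (\<lambda>q. ereal (E0 q))"

section \<open>Gradient systems\<close>

definition convex_ennreal :: "('m::real_vector \<Rightarrow> ennreal) \<Rightarrow> bool" where
  "convex_ennreal f \<longleftrightarrow> (\<forall>v w. \<forall>s\<in>{0..1}.
     f ((1 - s) *\<^sub>R v + s *\<^sub>R w) \<le> ennreal (1 - s) * f v + ennreal s * f w)"

definition lsc_ennreal :: "('m::topological_space \<Rightarrow> ennreal) \<Rightarrow> bool" where
  "lsc_ennreal f \<longleftrightarrow> (\<forall>v. f v \<le> Liminf (at v) f)"

text \<open>
  As \<open>R q\<close> takes values in \<open>[0,\<infinity>]\<close>, the condition \<open>R q 0 = 0\<close> says that 0 is its minimum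
  value, attained at 0.
\<close>

definition dissipation_potential :: "('q \<Rightarrow> 'm::real_normed_vector \<Rightarrow> ennreal) \<Rightarrow> bool" where
  "dissipation_potential R \<longleftrightarrow> (\<forall>q. convex_ennreal (R q) \<and> lsc_ennreal (R q) \<and> R q 0 = 0)"

text \<open>
  Legendre--Fenchel dual. The supremum is taken in the extended reals; it is nonnegative
  whenever \<open>f 0 = 0\<close>, so the conversion back to \<open>[0,\<infinity>]\<close> loses nothing for dissipation potentials.
\<close>

definition dual :: "('m::real_normed_vector \<Rightarrow> ennreal) \<Rightarrow> ('m \<Rightarrow>\<^sub>L real) \<Rightarrow> ennreal" where
  "dual f \<xi> = e2ennreal (SUP v. ereal (blinfun_apply \<xi> v) - enn2ereal (f v))"

definition subdifferential ::
  "('m::real_normed_vector \<Rightarrow> ennreal) \<Rightarrow> 'm \<Rightarrow> ('m \<Rightarrow>\<^sub>L real) set" where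
  "subdifferential f v = {\<xi>. f v < \<infinity> \<and>
     (\<forall>w. enn2ereal (f v) + ereal (blinfun_apply \<xi> (w - v)) \<le> enn2ereal (f w))}"

definition superlinear :: "('m \<Rightarrow> real) \<Rightarrow> ('m \<Rightarrow> ennreal) \<Rightarrow> bool" where
  "superlinear N f \<longleftrightarrow> ((\<lambda>v. f v / ennreal (N v)) \<longlongrightarrow> \<infinity>) (filtercomap N at_top)"

definition gradient_system ::
  "('q, 'm::real_normed_vector) chart set \<Rightarrow> ('q \<Rightarrow> real) \<Rightarrow> ('q \<Rightarrow> 'm \<Rightarrow> ennreal) \<Rightarrow> bool" where
  "gradient_system A E R \<longleftrightarrow> C1_function A E \<and> dissipation_potential R"

section \<open>Dissipation functionals and notions of convergence\<close>

text \<open>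
  The integral of a nonnegative function along a curve, extended by \<open>\<infinity>\<close> to curves that are not
  absolutely continuous. No measurability in \<open>q\<close> is built into dissipation potentials;
  for nonmeasurable integrands \<open>nn_integral\<close> is the lower integral.
\<close>

definition AC_integral ::
  "('q::topological_space, 'm::real_normed_vector) chart set \<Rightarrow> real \<Rightarrow>
   ('q \<Rightarrow> 'm \<Rightarrow> ennreal) \<Rightarrow> (real \<Rightarrow> 'q) \<Rightarrow> ennreal" where
  "AC_integral A T L u =
     (if AC_curve A T u then \<integral>\<^sup>+ t\<in>{0..T}. L (u t) (velocity A T u t) \<partial>lebesgue else \<infinity>)"

definition diss_functional ::
  "('q::topological_space, 'm::real_normed_vector) chart set \<Rightarrow> real \<Rightarrow> ('q \<Rightarrow> real) \<Rightarrow>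
   ('q \<Rightarrow> 'm \<Rightarrow> ennreal) \<Rightarrow> ('q \<Rightarrow> real) \<Rightarrow> (real \<Rightarrow> 'q) \<Rightarrow> ennreal" where
  "diss_functional A T E R F =
     AC_integral A T (\<lambda>q v. R q v + dual (R q) (- differential A E q - differential A F q))"

definition simple_EDP ::
  "('q::topological_space, 'm::real_normed_vector) chart set \<Rightarrow>
   (real \<Rightarrow> 'q \<Rightarrow> real) \<Rightarrow> (real \<Rightarrow> 'q \<Rightarrow> 'm \<Rightarrow> ennreal) \<Rightarrow>
   ('q \<Rightarrow> real) \<Rightarrow> ('q \<Rightarrow> 'm \<Rightarrow> ennreal) \<Rightarrow> bool" where
  "simple_EDP A E R E0 R0 \<longleftrightarrow> gradient_system A E0 R0 \<and> Gamma_converges_energy E E0 \<and>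
     (\<forall>T>0. Gamma_converges (curve_topology T)
        (\<lambda>\<epsilon>. diss_functional A T (E \<epsilon>) (R \<epsilon>) (\<lambda>_. 0)) (diss_functional A T E0 R0 (\<lambda>_. 0)))"

text \<open>
  The integrand of the untilted functional along a curve, and agreement of two dissipation
  potentials along curves. The limit functional does not determine a dissipation potential
  pointwise: for \<open>v \<noteq> 0\<close> no integral sees a change of \<open>R q v\<close> at a single point \<open>q\<close>.
\<close>

definition diss_along ::
  "('q, 'm::real_normed_vector) chart set \<Rightarrow> real \<Rightarrow> ('q \<Rightarrow> real) \<Rightarrow>
   ('q \<Rightarrow> 'm \<Rightarrow> ennreal) \<Rightarrow> (real \<Rightarrow> 'q) \<Rightarrow> real \<Rightarrow> ennreal" where
  "diss_along A T E R u t =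
     R (u t) (velocity A T u t) + dual (R (u t)) (- differential A E (u t))"

definition agree_along_curves ::
  "('q::topological_space, 'm::real_normed_vector) chart set \<Rightarrow> ('q \<Rightarrow> real) \<Rightarrow>
   ('q \<Rightarrow> 'm \<Rightarrow> ennreal) \<Rightarrow> ('q \<Rightarrow> 'm \<Rightarrow> ennreal) \<Rightarrow> bool" where
  "agree_along_curves A E R1 R2 \<longleftrightarrow>
     (\<forall>T>0. \<forall>u. AC_curve A T u \<and>
        diss_along A T E R1 u \<in> borel_measurable (lebesgue_on {0..T}) \<and>
        diss_along A T E R2 u \<in> borel_measurable (lebesgue_on {0..T}) \<and>
        diss_functional A T E R2 (\<lambda>_. 0) u < \<infinity> \<longrightarrow>
        (AE t in lebesgue_on {0..T}.
           R1 (u t) (velocity A T u t) = R2 (u t) (velocity A T u t)))"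

definition M0 ::
  "('q, 'm::real_normed_vector) chart set \<Rightarrow> ('q \<Rightarrow> real) \<Rightarrow>
   ('q \<Rightarrow> 'm \<Rightarrow> ('m \<Rightarrow>\<^sub>L real) \<Rightarrow> ennreal) \<Rightarrow> 'q \<Rightarrow> 'm \<Rightarrow> ('m \<Rightarrow>\<^sub>L real) \<Rightarrow> ennreal" where
  "M0 A E0 N0 q v \<xi> = N0 q v (\<xi> + differential A E0 q)"

text \<open>
  The limit integrand \<open>N0\<close> is a parameter, because the tilt and contact conditions are conditions
  on \<open>M0\<close>, hence on \<open>N0\<close>. It is not determined pointwise by the limit functionals.
\<close>

definition basic_assumptions ::
  "('q::topological_space, 'm::real_normed_vector) chart set \<Rightarrow>
   (real \<Rightarrow> 'q \<Rightarrow> real) \<Rightarrow> (real \<Rightarrow> 'q \<Rightarrow> 'm \<Rightarrow> ennreal) \<Rightarrow>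
   ('q \<Rightarrow> real) \<Rightarrow> ('q \<Rightarrow> 'm \<Rightarrow> ('m \<Rightarrow>\<^sub>L real) \<Rightarrow> ennreal) \<Rightarrow> bool" where
  "basic_assumptions A E R E0 N0 \<longleftrightarrow>
     Gamma_converges_energy E E0 \<and>
     (\<exists>D0 :: real \<Rightarrow> (real \<Rightarrow> 'q) \<Rightarrow> ('q \<Rightarrow> real) \<Rightarrow> ennreal.
        (\<forall>T>0. \<forall>F. C1_function A F \<longrightarrow>
           Gamma_converges (curve_topology T) (\<lambda>\<epsilon>. diss_functional A T (E \<epsilon>) (R \<epsilon>) F)
             (\<lambda>u. if AC_curve A T u then D0 T u F else \<infinity>)) \<and>
        (\<forall>T>0. \<forall>F u. C1_function A F \<and> AC_curve A T u \<longrightarrow>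
           D0 T u F = AC_integral A T (\<lambda>q v. N0 q v (- differential A F q)) u)) \<and>
     (\<forall>q \<eta>. convex_ennreal (\<lambda>v. N0 q v \<eta>) \<and> lsc_ennreal (\<lambda>v. N0 q v \<eta>)) \<and>
     (\<forall>q v \<xi>. ereal (blinfun_apply \<xi> v) \<le> enn2ereal (M0 A E0 N0 q v \<xi>)) \<and>
     (\<forall>q v \<xi>. M0 A E0 N0 q 0 \<xi> \<le> M0 A E0 N0 q v \<xi>)"

definition tilt_EDP ::
  "('q::topological_space, 'm::real_normed_vector) chart set \<Rightarrow>
   (real \<Rightarrow> 'q \<Rightarrow> real) \<Rightarrow> (real \<Rightarrow> 'q \<Rightarrow> 'm \<Rightarrow> ennreal) \<Rightarrow> ('q \<Rightarrow> real) \<Rightarrow>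
   ('q \<Rightarrow> 'm \<Rightarrow> ('m \<Rightarrow>\<^sub>L real) \<Rightarrow> ennreal) \<Rightarrow> ('q \<Rightarrow> 'm \<Rightarrow> ennreal) \<Rightarrow> bool" where
  "tilt_EDP A E R E0 N0 Rhat \<longleftrightarrow>
     gradient_system A E0 Rhat \<and> basic_assumptions A E R E0 N0 \<and>
     (\<forall>q v \<xi>. M0 A E0 N0 q v \<xi> = Rhat q v + dual (Rhat q) \<xi>)"

definition contact_EDP ::
  "('q::topological_space, 'm::real_normed_vector) chart set \<Rightarrow>
   (real \<Rightarrow> 'q \<Rightarrow> real) \<Rightarrow> (real \<Rightarrow> 'q \<Rightarrow> 'm \<Rightarrow> ennreal) \<Rightarrow> ('q \<Rightarrow> real) \<Rightarrow>
   ('q \<Rightarrow> 'm \<Rightarrow> ('m \<Rightarrow>\<^sub>L real) \<Rightarrow> ennreal) \<Rightarrow> ('q \<Rightarrow> 'm \<Rightarrow> ennreal) \<Rightarrow> bool" where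
  "contact_EDP A E R E0 N0 Reff \<longleftrightarrow>
     gradient_system A E0 Reff \<and> basic_assumptions A E R E0 N0 \<and>
     (\<forall>q. {(v, \<xi>). enn2ereal (M0 A E0 N0 q v \<xi>) = ereal (blinfun_apply \<xi> v)} =
          {(v, \<xi>). \<xi> \<in> subdifferential (Reff q) v})"

end

theory Submission
  imports Defs
begin

text \<open>
  Everything rests on the equality case of the Fenchel--Young inequality: for a dissipation potential
  \<open>P\<close>, the sum \<open>P(v) + P\<^sup>*(\<xi>)\<close> equals \<open>\<langle>\<xi>, v\<rangle>\<close> exactly if \<open>\<xi> \<in> \<partial>P(v)\<close>
  (\<open>Fenchel_Young_equality_iff\<close>). Applied to the limit potential of tilt-EDP convergence, this says
  that the contact set of \<open>M0\<close> is the graph of its subdifferential, so tilt-EDP convergence implies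
  contact-EDP convergence with the same potential.

  For the passage from contact-EDP to simple EDP convergence, let \<open>\<xi> = - DE0(q)\<close> and
  \<open>m(v) = M0(q, v, \<xi>)\<close>, which is the integrand of the limit functional without tilt. If \<open>Reff(q, _)\<close>
  is superlinear, then \<open>Reff(q, _) - \<xi>\<close> attains its minimum at some \<open>p\<close>
  (\<open>superlinear_imp_exists_subgradient\<close>), that is, \<open>\<xi> \<in> \<partial>Reff(q, p)\<close>, and therefore \<open>m(p) = \<langle>\<xi>, p\<rangle>\<close>.
  Together with \<open>m \<ge> \<xi>\<close> and \<open>m \<ge> m(0)\<close> this shows that \<open>R0 = m - m(0)\<close> is a dissipation
  potential with \<open>R0\<^sup>*(\<xi>) = m(0)\<close> (\<open>dual_minus_min_of_tight\<close>). Hence \<open>m = R0 + R0\<^sup>*(\<xi>)\<close>, as simple EDP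
  convergence requires.

  The effective potential is unique because a lower semicontinuous convex function with value 0 at
  0 is determined by its subdifferential (\<open>eq_if_subdifferential_eq\<close>). The subdifferential determines
  the proximal points and therefore the gradients of the Moreau envelopes, hence the envelopes
  themselves, and these converge to the function.

  The potential of simple EDP convergence is compared along curves. Gamma-limits are unique, so two
  such potentials yield the same limit functionals. Constant curves show that the dual terms at
  \<open>- DE0(q)\<close> agree for every \<open>q\<close> (\<open>simple_EDP_dual_unique\<close>). Comparing the functionals on all
  intervals \<open>[0, s]\<close> shows that the integrands agree almost everywhere along every curve of finite
  dissipation on which they are measurable (\<open>AE_eq_if_initial_integrals_eq\<close>), and subtraction of the
  dual terms leaves the equality of the potentials.
\<close>

section \<open>Fenchel duality for dissipation potentials\<close>

lemma subdifferential_iff_real: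
  assumes "f v = ennreal a" "a \<ge> 0"
  shows "\<xi> \<in> subdifferential f v \<longleftrightarrow>
    (\<forall>w b. b \<ge> 0 \<longrightarrow> f w = ennreal b \<longrightarrow> a + blinfun_apply \<xi> (w - v) \<le> b)"
proof -
  have "(\<forall>b. b \<ge> 0 \<longrightarrow> f w = ennreal b \<longrightarrow> a + blinfun_apply \<xi> (w - v) \<le> b) \<longleftrightarrow>
      enn2ereal (f v) + ereal (blinfun_apply \<xi> (w - v)) \<le> enn2ereal (f w)" for w
    using assms by (cases "f w") auto
  then show ?thesis
    using assms by (simp add: subdifferential_def)
qed

lemma enn2ereal_dual:
  assumes "f 0 = 0"
  shows "enn2ereal (dual f \<xi>) = (SUP v. ereal (blinfun_apply \<xi> v) - enn2ereal (f v))"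
proof -
  have "ereal (blinfun_apply \<xi> 0) - enn2ereal (f 0) \<le>
      (SUP v. ereal (blinfun_apply \<xi> v) - enn2ereal (f v))"
    by (rule SUP_upper) simp
  then show ?thesis
    using assms unfolding dual_def
    by (intro enn2ereal_e2ennreal) (simp add: zero_ennreal.rep_eq zero_ereal_def)
qed

lemma dual_at_subgradient:
  assumes "f 0 = 0" "f v = ennreal a" "a \<ge> 0" "\<xi> \<in> subdifferential f v"
  shows "enn2ereal (dual f \<xi>) = ereal (blinfun_apply \<xi> v - a)"
  unfolding enn2ereal_dual[where f=f, OF assms(1)]
proof (rule SUP_eqI)
  fix w
  show "ereal (blinfun_apply \<xi> w) - enn2ereal (f w) \<le> ereal (blinfun_apply \<xi> v - a)"
  proof (cases "f w")
    case (real b)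
    then have "a + blinfun_apply \<xi> (w - v) \<le> b"
      using assms(4) unfolding subdifferential_iff_real[where f=f, OF assms(2,3)] by blast
    then show ?thesis
      using real by (simp add: blinfun.diff_right)
  qed simp
next
  fix y
  assume "\<And>w. w \<in> UNIV \<Longrightarrow> ereal (blinfun_apply \<xi> w) - enn2ereal (f w) \<le> y"
  from this[of v] show "ereal (blinfun_apply \<xi> v - a) \<le> y"
    using assms by simp
qed

lemma Fenchel_Young_equality_iff:
  assumes "f 0 = 0"
  shows "enn2ereal (f v + dual f \<xi>) = ereal (blinfun_apply \<xi> v) \<longleftrightarrow> \<xi> \<in> subdifferential f v"
proof
  assume eq: "enn2ereal (f v + dual f \<xi>) = ereal (blinfun_apply \<xi> v)"
  obtain a where a: "f v = ennreal a" "a \<ge> 0"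
    using eq by (cases "f v") auto
  obtain b where b: "dual f \<xi> = ennreal b" "b \<ge> 0"
    using eq by (cases "dual f \<xi>") auto
  have ab: "a + b = blinfun_apply \<xi> v"
    using eq a b by (simp add: plus_ennreal.rep_eq)
  have "blinfun_apply \<xi> w - c \<le> b" if "c \<ge> 0" "f w = ennreal c" for w c
  proof -
    have "ereal (blinfun_apply \<xi> w) - enn2ereal (f w) \<le> enn2ereal (dual f \<xi>)"
      unfolding enn2ereal_dual[where f=f, OF assms] by (rule SUP_upper) simp
    then show ?thesis
      using that b by simp
  qed
  then show "\<xi> \<in> subdifferential f v"
    unfolding subdifferential_iff_real[where f=f, OF a] using ab
    by (fastforce simp: blinfun.diff_right)
next
  assume sub: "\<xi> \<in> subdifferential f v"
  then obtain a where a: "f v = ennreal a" "a \<ge> 0"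
    unfolding subdifferential_def by (cases "f v") auto
  show "enn2ereal (f v + dual f \<xi>) = ereal (blinfun_apply \<xi> v)"
    using dual_at_subgradient[where f=f, OF assms a sub] a by (simp add: plus_ennreal.rep_eq)
qed

section \<open>Minimisers of lower semicontinuous functions\<close>

lemma lsc_ennreal_eventually:
  assumes "lsc_ennreal f" "c < f x"
  shows "eventually (\<lambda>y. c < f y) (nhds x)"
proof -
  have "eventually (\<lambda>y. c < f y) (at x)"
    using assms unfolding lsc_ennreal_def le_Liminf_iff by blast
  then show ?thesis
    unfolding eventually_at_filter by (rule eventually_mono) (use assms(2) in auto)
qed

lemma open_superlevel_lsc_plus_continuous:
  fixes f :: "'a::t2_space \<Rightarrow> ennreal" and h :: "'a \<Rightarrow> real"
  assumes "lsc_ennreal f" "continuous_on UNIV h"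
  shows "open {x. ereal s < enn2ereal (f x) + ereal (h x)}"
proof (subst open_subopen, safe)
  fix x assume x: "ereal s < enn2ereal (f x) + ereal (h x)"
  then have "ereal (s - h x) < enn2ereal (f x)"
    by (cases "f x") auto
  then obtain r where r: "ereal (s - h x) < ereal r" "ereal r < enn2ereal (f x)"
    using ereal_dense2[of "ereal (s - h x)" "enn2ereal (f x)"] by fast
  have 1: "eventually (\<lambda>y. ereal r < enn2ereal (f y)) (nhds x)"
  proof (cases "r < 0")
    case True
    then show ?thesis
      by (intro always_eventually allI)
        (rule less_le_trans[OF _ enn2ereal_nonneg], simp)
  next
    case False
    then have *: "ereal r < enn2ereal (f y) \<longleftrightarrow> ennreal r < f y" for y
      by (simp add: less_ennreal.rep_eq)
    have "ennreal r < f x"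
      using r(2) by (simp only: *)
    then show ?thesis
      by (simp only: * lsc_ennreal_eventually[OF assms(1)])
  qed
  have "(h \<longlongrightarrow> h x) (nhds x)"
    using assms(2) by (simp add: continuous_on_eq_continuous_at isCont_def tendsto_nhds_iff)
  then have 2: "eventually (\<lambda>y. s - r < h y) (nhds x)"
    using r(1) by (simp add: order_tendstoD(1))
  from 1 2 have "eventually (\<lambda>y. ereal s < enn2ereal (f y) + ereal (h y)) (nhds x)"
  proof eventually_elim
    case (elim y)
    show ?case
    proof (cases "f y")
      case (real b)
      then show ?thesis using elim by simp
    qed simp
  qed
  then show "\<exists>T. open T \<and> x \<in> T \<and> T \<subseteq> {x. ereal s < enn2ereal (f x) + ereal (h x)}"
    by (simp add: eventually_nhds subset_eq)
qed

text \<open>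
  The Weierstrass argument, stated without infinite values: if no point of \<open>K\<close> were minimal, the
  open sets on which \<open>f + h\<close> exceeds its finite values on \<open>K\<close> would cover \<open>K\<close>.
\<close>

lemma exists_minimiser_lsc_plus_continuous:
  fixes f :: "'a::{t2_space, zero} \<Rightarrow> ennreal" and h :: "'a \<Rightarrow> real"
  assumes lsc: "lsc_ennreal f" and h: "continuous_on UNIV h" and f0: "f 0 = 0"
    and K: "compact K" "0 \<in> K" and out: "\<And>v. v \<notin> K \<Longrightarrow> ereal (h 0) \<le> enn2ereal (f v) + ereal (h v)"
  obtains p a where "f p = ennreal a" "a \<ge> 0"
    "\<And>w b. b \<ge> 0 \<Longrightarrow> f w = ennreal b \<Longrightarrow> a + h p \<le> b + h w"
proof -
  define \<Phi> where "\<Phi> x = enn2ereal (f x) + ereal (h x)" for x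
  have \<Phi>0: "\<Phi> 0 = ereal (h 0)"
    by (simp add: \<Phi>_def f0 zero_ennreal.rep_eq)
  have fin: "\<exists>s. \<Phi> y = ereal s" if "\<Phi> y \<le> \<Phi> 0" for y
    using that by (cases "f y") (auto simp: \<Phi>_def f0 zero_ennreal.rep_eq)
  have "\<exists>p\<in>K. \<forall>y\<in>K. \<Phi> p \<le> \<Phi> y"
  proof (rule ccontr)
    assume "\<not> ?thesis"
    then have no: "\<forall>x\<in>K. \<exists>y\<in>K. \<Phi> y < \<Phi> x"
      by (auto simp: not_le)
    define C where "C = {y\<in>K. \<Phi> y \<le> \<Phi> 0}"
    have op: "open {x. \<Phi> y < \<Phi> x}" if y: "y \<in> C" for y
    proof -
      obtain s where "\<Phi> y = ereal s"
        using fin[of y] y unfolding C_def by blast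
      then show ?thesis
        using open_superlevel_lsc_plus_continuous[OF lsc h, of s] by (simp add: \<Phi>_def)
    qed
    have cov: "K \<subseteq> (\<Union>y\<in>C. {x. \<Phi> y < \<Phi> x})"
    proof
      fix x assume "x \<in> K"
      show "x \<in> (\<Union>y\<in>C. {x. \<Phi> y < \<Phi> x})"
      proof (cases "\<Phi> x \<le> \<Phi> 0")
        case True
        with no \<open>x \<in> K\<close> obtain y where "y \<in> K" "\<Phi> y < \<Phi> x" by blast
        with True show ?thesis by (auto simp: C_def intro!: exI[of _ y])
      next
        case False
        then show ?thesis using K by (auto simp: C_def intro!: bexI[of _ 0])
      qed
    qed
    obtain D where D: "D \<subseteq> C" "finite D" "K \<subseteq> (\<Union>y\<in>D. {x. \<Phi> y < \<Phi> x})"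
      using compactE_image[OF K(1) op cov] by blast
    have "0 \<in> (\<Union>y\<in>D. {x. \<Phi> y < \<Phi> x})"
      using D(3) K(2) by (rule subsetD)
    then have "D \<noteq> {}" by blast
    then have "Min (\<Phi> ` D) \<in> \<Phi> ` D"
      using D(2) by simp
    then obtain m where m: "\<Phi> m = Min (\<Phi> ` D)" "m \<in> D"
      by (metis imageE)
    then have "m \<in> K" using D(1) C_def by blast
    then have "m \<in> (\<Union>y\<in>D. {x. \<Phi> y < \<Phi> x})" using D(3) by (rule rev_subsetD)
    then obtain y where y: "y \<in> D" "\<Phi> y < \<Phi> m" by blast
    have "Min (\<Phi> ` D) \<le> \<Phi> y"
      using D(2) y(1) by simp
    then show False using m(1) y(2) by simp
  qed
  then obtain p where p: "p \<in> K" "\<And>y. y \<in> K \<Longrightarrow> \<Phi> p \<le> \<Phi> y" by blast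
  have min: "\<Phi> p \<le> \<Phi> y" for y
    using p K(2) out[of y] \<Phi>0 by (metis \<Phi>_def order_trans)
  obtain a where a: "f p = ennreal a" "a \<ge> 0"
    using min[of 0] \<Phi>0 by (cases "f p") (auto simp: \<Phi>_def)
  show ?thesis
  proof (rule that[OF a])
    fix w and b :: real assume "b \<ge> 0" "f w = ennreal b"
    then show "a + h p \<le> b + h w"
      using min[of w] a by (simp add: \<Phi>_def)
  qed
qed

section \<open>A potential is determined by its subdifferential\<close>

text \<open>
  The point \<open>p\<close> is obtained as the minimiser of \<open>w \<mapsto> f w + k/2 * |x - w|\<^sup>2\<close>; the inclusion is the first order
  condition, with the Riesz isomorphism turning the vector \<open>k (x - p)\<close> into a covector.
\<close>

lemma exists_proximal_point:
  fixes f :: "'m::{real_inner, heine_borel} \<Rightarrow> ennreal"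
  assumes conv: "convex_ennreal f" and lsc: "lsc_ennreal f" and f0: "f 0 = 0" and k: "k > 0"
  shows "\<exists>p. blinfun_inner_right (k *\<^sub>R (x - p)) \<in> subdifferential f p"
proof -
  define h where "h v = k / 2 * (norm (x - v))\<^sup>2" for v
  have out: "ereal (h 0) \<le> enn2ereal (f v) + ereal (h v)" if "v \<notin> cball 0 (2 * norm x)" for v
  proof -
    have "norm x \<le> norm (x - v)"
      using that norm_triangle_ineq2[of v x] by (simp add: norm_minus_commute)
    then have "h 0 \<le> h v"
      using k by (simp add: h_def power_mono)
    then show ?thesis
      by (cases "f v") auto
  qed
  have "continuous_on UNIV h"
    unfolding h_def by (intro continuous_intros)
  then obtain p a where a: "f p = ennreal a" "a \<ge> 0"
    and min: "\<And>w b. b \<ge> 0 \<Longrightarrow> f w = ennreal b \<Longrightarrow> a + h p \<le> b + h w"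
    using exists_minimiser_lsc_plus_continuous[OF lsc _ f0 compact_cball[of 0 "2 * norm x"] _ out]
    by auto
  have "a + k * inner (x - p) (w - p) \<le> b" if b: "b \<ge> 0" "f w = ennreal b" for w b
  proof -
    \<comment> \<open>The minimum at \<open>p\<close> is compared with the values on the segment from \<open>p\<close> to \<open>w\<close>; after
      division by the parameter \<open>s\<close>, the limit \<open>s \<rightarrow> 0\<close> gives the claim.\<close>
    have est: "a - b + k * inner (x - p) (w - p) \<le> k / 2 * (norm (w - p))\<^sup>2 * s"
      if s: "0 < s" "s < 1" for s
    proof -
      let ?y = "(1 - s) *\<^sub>R p + s *\<^sub>R w"
      have le: "f ?y \<le> ennreal ((1 - s) * a + s * b)"
      proof -
        have "f ?y \<le> ennreal (1 - s) * f p + ennreal s * f w"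
          using conv s unfolding convex_ennreal_def by auto
        then show ?thesis
          using s a b by (simp flip: ennreal_mult ennreal_plus)
      qed
      then obtain c where c: "f ?y = ennreal c" "c \<ge> 0"
        by (cases "f ?y") (auto simp: top_unique)
      have "0 \<le> (1 - s) * a + s * b"
        using s a b by simp
      then have "c \<le> (1 - s) * a + s * b"
        using le c by simp
      moreover have "x - ?y = (x - p) - s *\<^sub>R (w - p)"
        by (simp add: algebra_simps)
      then have "h ?y = h p - k * s * inner (x - p) (w - p) + k / 2 * (norm (w - p))\<^sup>2 * s * s"
        unfolding h_def power2_norm_eq_inner
        by (simp only:) (simp add: inner_diff inner_commute algebra_simps)
      moreover have "a + h p \<le> c + h ?y"
        using min[OF c(2,1)] .
      ultimately have "s * (a - b + k * inner (x - p) (w - p)) \<le> s * (k / 2 * (norm (w - p))\<^sup>2 * s)"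
        by (simp add: algebra_simps)
      then show ?thesis
        using s by simp
    qed
    have "((\<lambda>s. k / 2 * (norm (w - p))\<^sup>2 * s) \<longlongrightarrow> k / 2 * (norm (w - p))\<^sup>2 * 0) (at_right 0)"
      by (intro tendsto_intros)
    moreover have "eventually (\<lambda>s. a - b + k * inner (x - p) (w - p) \<le> k / 2 * (norm (w - p))\<^sup>2 * s) (at_right 0)"
      using eventually_at_right_real[of 0 1] by (rule eventually_mono) (use est in auto)
    ultimately have "a - b + k * inner (x - p) (w - p) \<le> k / 2 * (norm (w - p))\<^sup>2 * 0"
      by (rule tendsto_lowerbound) simp
    then show ?thesis by simp
  qed
  then have "blinfun_inner_right (k *\<^sub>R (x - p)) \<in> subdifferential f p"
    unfolding subdifferential_iff_real[where f=f, OF a] by simp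
  then show ?thesis ..
qed

text \<open>
  The function \<open>e\<close> is the Moreau envelope \<open>x \<mapsto> min\<^sub>w (f w + k/2 * |x - w|\<^sup>2)\<close>: by the first bound the
  minimum is attained at \<open>P x\<close>. The other two say that \<open>e\<close> is differentiable with gradient
  \<open>k (x - P x)\<close>, with a remainder that is quadratic uniformly in \<open>x\<close>. The hypothesis on \<open>P\<close>, and
  hence the gradient, involves \<open>f\<close> through its subdifferential only.
\<close>

lemma Moreau_envelope_bounds:
  fixes f :: "'m::real_inner \<Rightarrow> ennreal"
  assumes k: "k > 0" and P: "\<And>x. blinfun_inner_right (k *\<^sub>R (x - P x)) \<in> subdifferential f (P x)"
  defines "e \<equiv> \<lambda>x. enn2real (f (P x)) + k / 2 * (norm (x - P x))\<^sup>2"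
  shows "\<And>b w x. b \<ge> 0 \<Longrightarrow> f w = ennreal b \<Longrightarrow> e x \<le> b + k / 2 * (norm (x - w))\<^sup>2"
    and "\<And>x y. e x + k * inner (x - P x) (y - x) \<le> e y"
    and "\<And>x y. e y \<le> e x + k * inner (x - P x) (y - x) + k / 2 * (norm (y - x))\<^sup>2"
proof -
  have fin: "f (P x) = ennreal (enn2real (f (P x)))" for x
    using P[of x] by (auto simp: subdifferential_def)
  have sub: "enn2real (f (P x)) + k * inner (x - P x) (w - P x) \<le> b"
    if "b \<ge> 0" "f w = ennreal b" for b w x
    using P[of x] that
    unfolding subdifferential_iff_real[where f=f, OF fin enn2real_nonneg] by auto
  show 1: "e x \<le> b + k / 2 * (norm (x - w))\<^sup>2" if "b \<ge> 0" "f w = ennreal b" for b w x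
  proof -
    have eq: "x - w = (x - P x) - (w - P x)" by simp
    have "k / 2 * (norm (x - w))\<^sup>2 =
        k / 2 * (norm (x - P x))\<^sup>2 - k * inner (x - P x) (w - P x) + k / 2 * (norm (w - P x))\<^sup>2"
      unfolding eq power2_norm_eq_inner
      by (simp only: inner_diff_left[of "x - P x" "w - P x"] inner_diff_right[of _ "x - P x" "w - P x"])
        (simp add: inner_commute algebra_simps)
    moreover have "k / 2 * (norm (w - P x))\<^sup>2 \<ge> 0" using k by simp
    ultimately show ?thesis
      using sub[OF that, of x] unfolding e_def by linarith
  qed
  show "e x + k * inner (x - P x) (y - x) \<le> e y" for x y
  proof -
    let ?a = "y - P y" and ?b = "x - P x"
    have "P y - P x = (y - x) - ?a + ?b" by simp
    then have "inner ?b (P y - P x) = inner ?b (y - x) - inner ?b ?a + inner ?b ?b"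
      by (metis inner_add_right inner_diff_right)
    moreover have "0 \<le> k / 2 * (norm (?a - ?b))\<^sup>2" using k by simp
    then have "0 \<le> k / 2 * (norm ?a)\<^sup>2 - k * inner ?b ?a + k / 2 * (norm ?b)\<^sup>2"
      unfolding power2_norm_eq_inner
      by (simp only: inner_diff_left[of ?a ?b] inner_diff_right[of _ ?a ?b])
        (simp add: inner_commute algebra_simps)
    moreover have "enn2real (f (P x)) + k * inner ?b (P y - P x) \<le> enn2real (f (P y))"
      using sub[OF enn2real_nonneg fin] .
    ultimately show ?thesis
      unfolding e_def power2_norm_eq_inner by (simp add: distrib_left right_diff_distrib)
  qed
  show "e y \<le> e x + k * inner (x - P x) (y - x) + k / 2 * (norm (y - x))\<^sup>2" for x y
  proof -
    have eq: "y - P x = (x - P x) + (y - x)" by simp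
    have "k / 2 * (norm (y - P x))\<^sup>2 =
        k / 2 * (norm (x - P x))\<^sup>2 + k * inner (x - P x) (y - x) + k / 2 * (norm (y - x))\<^sup>2"
      unfolding eq power2_norm_eq_inner
      by (simp only: inner_add_left[of "x - P x" "y - x"] inner_add_right[of _ "x - P x" "y - x"])
        (simp add: inner_commute algebra_simps)
    then show ?thesis
      using 1[OF enn2real_nonneg fin, of y x] unfolding e_def by linarith
  qed
qed

lemma constant_if_quadratically_close:
  fixes d :: "'a::real_normed_vector \<Rightarrow> real"
  assumes "\<And>x y. \<bar>d y - d x\<bar> \<le> C * (norm (y - x))\<^sup>2"
  shows "d x = d y"
proof -
  have "(d has_derivative (\<lambda>h. 0)) (at x)" for x
  proof (rule has_derivativeI_sandwich[where H = "\<lambda>y. C * norm (y - x)" and e = 1])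
    show "((\<lambda>y. C * norm (y - x)) \<longlongrightarrow> 0) (at x)"
    proof -
      have "((\<lambda>y. C * norm (y - x)) \<longlongrightarrow> C * norm (x - x)) (at x)"
        by (intro tendsto_intros)
      then show ?thesis by simp
    qed
    show "norm (d y - d x - 0) / norm (y - x) \<le> C * norm (y - x)" if "y \<noteq> x" for y
      using assms[of y x] that by (simp add: divide_le_eq power2_eq_square)
  qed simp_all
  then have "\<exists>c. \<forall>x\<in>UNIV. d x = c"
    by (intro has_derivative_zero_constant) simp_all
  then show ?thesis by (metis UNIV_I)
qed

text \<open>
  By the gradient bounds the Moreau envelopes of \<open>f1\<close> and \<open>f2\<close> differ by a constant, which is 0
  because both vanish at 0. The envelope of \<open>f1\<close> at \<open>x\<close> is at most \<open>f1 x\<close>, that of \<open>f2\<close> at \<open>x\<close>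
  tends to \<open>f2 x\<close> as \<open>k \<rightarrow> \<infinity>\<close> by lower semicontinuity.
\<close>

lemma le_if_subdifferential_eq:
  fixes f1 f2 :: "'m::{real_inner, heine_borel} \<Rightarrow> ennreal"
  assumes conv: "convex_ennreal f1" and lsc: "lsc_ennreal f1" "lsc_ennreal f2"
    and zero: "f1 0 = 0" "f2 0 = 0"
    and eq: "\<And>v. subdifferential f1 v = subdifferential f2 v"
  shows "f2 x \<le> f1 x"
proof (rule ccontr)
  assume "\<not> ?thesis"
  then have "f1 x < f2 x" by simp
  then obtain b where b: "f1 x = ennreal b" "b \<ge> 0"
    by (cases "f1 x") auto
  obtain c where c: "f1 x < c" "c < f2 x"
    using dense[OF \<open>f1 x < f2 x\<close>] by blast
  then obtain c' where c': "c = ennreal c'" "c' \<ge> 0" by (cases c) simp_all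
  have bc: "b < c'" using c(1) b c' by (simp add: ennreal_less_iff)
  have "eventually (\<lambda>y. c < f2 y) (nhds x)"
    using lsc_ennreal_eventually[where f=f2, OF lsc(2) c(2)] .
  then obtain \<delta> where \<delta>: "\<delta> > 0" "\<And>y. dist y x < \<delta> \<Longrightarrow> c < f2 y"
    by (auto simp: eventually_nhds_metric)
  \<comment> \<open>So large that the penalty alone exceeds \<open>c'\<close> at distance \<open>\<delta>\<close> from \<open>x\<close>.\<close>
  define k where "k = 2 * (c' + 1) / \<delta>\<^sup>2"
  have k: "k > 0" using \<delta> c' by (simp add: k_def)
  have "\<forall>x. \<exists>p. blinfun_inner_right (k *\<^sub>R (x - p)) \<in> subdifferential f1 p"
    using exists_proximal_point[where f=f1, OF conv lsc(1) zero(1) k] by simp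
  then obtain P where P1: "\<And>x. blinfun_inner_right (k *\<^sub>R (x - P x)) \<in> subdifferential f1 (P x)"
    by (auto dest!: choice)
  then have P2: "\<And>x. blinfun_inner_right (k *\<^sub>R (x - P x)) \<in> subdifferential f2 (P x)"
    using eq by simp
  define e where "e f x = enn2real (f (P x)) + k / 2 * (norm (x - P x))\<^sup>2" for f :: "'m \<Rightarrow> ennreal" and x
  have e_nonneg: "0 \<le> e f x" for f x
    using k by (simp add: e_def)
  note B1 = Moreau_envelope_bounds[where f=f1 and P=P, OF k P1, folded e_def]
  note B2 = Moreau_envelope_bounds[where f=f2 and P=P, OF k P2, folded e_def]
  have "\<bar>(e f1 y - e f2 y) - (e f1 z - e f2 z)\<bar> \<le> k / 2 * (norm (y - z))\<^sup>2" for y z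
    using B1(2,3)[of z y] B1(3)[where x=z and y=y] B2(2)[of z y] B2(3)[where x=z and y=y]
    by linarith
  then have "e f1 x - e f2 x = e f1 0 - e f2 0"
    by (rule constant_if_quadratically_close)
  moreover have "e f1 0 = 0"
    using B1(1)[of 0 0 0] zero e_nonneg[of f1 0] by simp
  moreover have "e f2 0 = 0"
    using B2(1)[of 0 0 0] zero e_nonneg[of f2 0] by simp
  ultimately have "e f1 x = e f2 x" by simp
  moreover have "e f1 x < c'"
    using B1(1)[OF b(2,1), of x] bc by simp
  moreover have "c' \<le> e f2 x"
  proof (cases "dist (P x) x < \<delta>")
    case True
    then have "c < f2 (P x)" using \<delta>(2) by simp
    moreover have "f2 (P x) \<noteq> \<infinity>" using P2[of x] by (auto simp: subdifferential_def)
    ultimately have "c' \<le> enn2real (f2 (P x))"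
      using c' by (cases "f2 (P x)") (simp_all add: ennreal_less_iff)
    then show ?thesis using k by (simp add: e_def add_increasing2)
  next
    case False
    then have "\<delta>\<^sup>2 \<le> (norm (x - P x))\<^sup>2"
      using \<delta>(1) by (intro power_mono) (auto simp: dist_norm norm_minus_commute)
    then have "k / 2 * \<delta>\<^sup>2 \<le> k / 2 * (norm (x - P x))\<^sup>2"
      using k by simp
    moreover have "k / 2 * \<delta>\<^sup>2 = c' + 1" using \<delta> by (simp add: k_def)
    ultimately show ?thesis
      using enn2real_nonneg[of "f2 (P x)"] unfolding e_def by linarith
  qed
  ultimately show False by simp
qed

lemma eq_if_subdifferential_eq:
  fixes f1 f2 :: "'m::{real_inner, heine_borel} \<Rightarrow> ennreal"
  assumes "convex_ennreal f1" "convex_ennreal f2" "lsc_ennreal f1" "lsc_ennreal f2"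
    and "f1 0 = 0" "f2 0 = 0"
    and "\<And>v. subdifferential f1 v = subdifferential f2 v"
  shows "f1 = f2"
proof
  fix x
  show "f1 x = f2 x"
    using le_if_subdifferential_eq[of f1 f2 x] le_if_subdifferential_eq[of f2 f1 x] assms by simp
qed

section \<open>Subgradients of superlinear potentials\<close>

lemma positive_bilinear_norm_lower_bound:
  fixes B :: "'m::{real_inner, heine_borel} \<Rightarrow> 'm \<Rightarrow> real"
  assumes B: "bounded_bilinear B" and pos: "\<And>v. v \<noteq> 0 \<Longrightarrow> 0 < B v v"
  shows "\<exists>c>0. \<forall>v. c * norm v \<le> sqrt (B v v)"
proof (cases "sphere (0::'m) 1 = {}")
  case True
  have "v = 0" for v :: 'm
  proof (rule ccontr)
    assume "v \<noteq> 0"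
    then have "v /\<^sub>R norm v \<in> sphere 0 1" by simp
    with True show False by simp
  qed
  then have "1 * norm v \<le> sqrt (B v v)" for v
    using bounded_bilinear.zero_left[OF B] by (metis mult_1 norm_zero order_refl real_sqrt_zero)
  then show ?thesis by (intro exI[of _ 1]) simp
next
  case False
  have "continuous_on (sphere 0 1) (\<lambda>v. sqrt (B v v))"
    by (intro continuous_intros bounded_bilinear.continuous_on[OF B])
  moreover have "compact (sphere (0::'m) 1)"
    unfolding compact_eq_bounded_closed
  proof
    show "bounded (sphere (0::'m) 1)"
      by (rule bounded_subset[OF bounded_cball[of 0 1]]) auto
    show "closed (sphere (0::'m) 1)"
      unfolding sphere_def by (intro closed_Collect_eq continuous_intros)
  qed
  ultimately have "\<exists>u\<in>sphere 0 1. \<forall>v\<in>sphere 0 1. sqrt (B u u) \<le> sqrt (B v v)"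
    using continuous_attains_inf[of "sphere (0::'m) 1" "\<lambda>v. sqrt (B v v)"] False by simp
  then obtain u where u: "u \<in> sphere 0 1" "\<And>v. v \<in> sphere 0 1 \<Longrightarrow> sqrt (B u u) \<le> sqrt (B v v)"
    by blast
  have "u \<noteq> 0" using u(1) by auto
  then have cpos: "0 < sqrt (B u u)" using pos by simp
  have "sqrt (B u u) * norm v \<le> sqrt (B v v)" for v
  proof (cases "v = 0")
    case True
    then show ?thesis by (simp add: bounded_bilinear.zero_left[OF B])
  next
    case False
    have "sqrt (B u u) \<le> sqrt (B (v /\<^sub>R norm v) (v /\<^sub>R norm v))"
      using u(2) False by simp
    also have "B (v /\<^sub>R norm v) (v /\<^sub>R norm v) = B v v / (norm v)\<^sup>2"
      by (simp add: bounded_bilinear.scaleR_left[OF B] bounded_bilinear.scaleR_right[OF B]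
          power2_eq_square divide_simps)
    also have "sqrt \<dots> = sqrt (B v v) / norm v"
      by (simp add: real_sqrt_divide)
    finally show ?thesis
      using False by (simp add: field_simps)
  qed
  with cpos show ?thesis by blast
qed

lemma superlinear_imp_exists_subgradient:
  fixes f :: "'m::{real_inner, heine_borel} \<Rightarrow> ennreal"
  assumes sup: "superlinear N f" and c: "c > 0" "\<And>v. c * norm v \<le> N v"
    and lsc: "lsc_ennreal f" and f0: "f 0 = 0"
  obtains p where "\<xi> \<in> subdifferential f p"
proof -
  \<comment> \<open>The function \<open>M * N\<close> dominates \<open>\<xi>\<close>, and \<open>f\<close> eventually dominates \<open>M * N\<close>. So \<open>f - \<xi>\<close> is
    nonnegative outside a ball and attains its minimum inside it.\<close>
  define M where "M = norm \<xi> / c"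
  have M: "M \<ge> 0" using c by (simp add: M_def)
  have "eventually (\<lambda>v. ennreal M < f v / ennreal (N v)) (filtercomap N at_top)"
    using sup unfolding superlinear_def by (rule order_tendstoD) simp
  then obtain K0 where K0: "\<And>v. K0 \<le> N v \<Longrightarrow> ennreal M < f v / ennreal (N v)"
    unfolding eventually_filtercomap eventually_at_top_linorder by blast
  define K where "K = max K0 1"
  have out: "ereal (- blinfun_apply \<xi> 0) \<le> enn2ereal (f v) + ereal (- blinfun_apply \<xi> v)"
    if v: "v \<notin> cball 0 (K / c)" for v
  proof (cases "f v")
    case (real b)
    have "K < N v"
      using v c(1) c(2)[of v] by (simp add: field_simps)
    then have Nv: "K0 \<le> N v" "N v > 0"
      by (auto simp: K_def)
    have "ennreal M < ennreal (b / N v)"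
      using K0[OF Nv(1)] real Nv(2) by (simp add: divide_ennreal)
    then have "M < b / N v"
      using M by (simp add: ennreal_less_iff)
    then have "M * N v \<le> b"
      using Nv(2) by (simp add: field_simps)
    moreover have "norm \<xi> * norm v \<le> M * N v"
      using mult_left_mono[OF c(2)[of v] M] c(1) by (simp add: M_def)
    moreover have "blinfun_apply \<xi> v \<le> norm \<xi> * norm v"
      using norm_blinfun[of \<xi> v] by simp
    ultimately show ?thesis
      using real by simp
  qed simp
  have cont: "continuous_on UNIV (\<lambda>v. - blinfun_apply \<xi> v)"
    by (intro continuous_intros)
  have "0 \<in> cball 0 (K / c)"
    using c by (simp add: K_def)
  then obtain p a where a: "f p = ennreal a" "a \<ge> 0"
    and min: "\<And>w b. b \<ge> 0 \<Longrightarrow> f w = ennreal b \<Longrightarrow> a + - blinfun_apply \<xi> p \<le> b + - blinfun_apply \<xi> w"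
    using exists_minimiser_lsc_plus_continuous[where f=f and h="\<lambda>v. - blinfun_apply \<xi> v",
        OF lsc cont f0 compact_cball[of 0 "K / c"] _ out]
    by blast
  have "\<xi> \<in> subdifferential f p"
    unfolding subdifferential_iff_real[where f=f, OF a]
  proof (intro allI impI)
    fix w and b :: real assume "0 \<le> b" "f w = ennreal b"
    from min[OF this] show "a + blinfun_apply \<xi> (w - p) \<le> b"
      by (simp add: blinfun.diff_right)
  qed
  then show ?thesis by (rule that)
qed

lemma dual_finite_if_subgradient:
  assumes "f 0 = 0" "\<xi> \<in> subdifferential f p"
  shows "dual f \<xi> \<noteq> \<infinity>"
proof
  assume "dual f \<xi> = \<infinity>"
  moreover have "enn2ereal (f p + dual f \<xi>) = ereal (blinfun_apply \<xi> p)"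
    using Fenchel_Young_equality_iff[of f p \<xi>] assms by simp
  ultimately show False by simp
qed

section \<open>Splitting an integrand at its minimum\<close>

lemma convex_ennreal_minus_min:
  assumes conv: "convex_ennreal m" and min: "\<And>v. m 0 \<le> m v" and fin: "m 0 \<noteq> \<infinity>"
  shows "convex_ennreal (\<lambda>v. m v - m 0)"
  unfolding convex_ennreal_def
proof (intro allI ballI)
  fix v w and s :: real assume s: "s \<in> {0..1}"
  let ?a = "m v - m 0" and ?b = "m w - m 0"
  have vw: "m v = ?a + m 0" "m w = ?b + m 0"
    using min by (simp_all add: diff_add_cancel_ennreal)
  have "ennreal (1 - s) + ennreal s = 1"
    using s by (simp flip: ennreal_plus)
  then have one: "ennreal (1 - s) * m 0 + ennreal s * m 0 = m 0"
    by (metis distrib_right mult_1)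
  have "m ((1 - s) *\<^sub>R v + s *\<^sub>R w) \<le> ennreal (1 - s) * m v + ennreal s * m w"
    using conv s unfolding convex_ennreal_def by blast
  also have "\<dots> = ennreal (1 - s) * (?a + m 0) + ennreal s * (?b + m 0)"
    using vw by simp
  also have "\<dots> = m 0 + (ennreal (1 - s) * ?a + ennreal s * ?b)"
    by (subst (3) one[symmetric]) (simp add: distrib_left add_ac)
  finally show "m ((1 - s) *\<^sub>R v + s *\<^sub>R w) - m 0 \<le> ennreal (1 - s) * ?a + ennreal s * ?b"
    by (rule ennreal_minus_le_iff[THEN iffD2, OF conjI]) (use fin in auto)
qed

lemma lsc_ennreal_minus_const:
  assumes lsc: "lsc_ennreal m" and fin: "c \<noteq> \<infinity>"
  shows "lsc_ennreal (\<lambda>v. m v - c)"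
  unfolding lsc_ennreal_def le_Liminf_iff
proof (intro allI impI)
  have c: "c < top" using fin by (simp add: less_top)
  fix v y assume "y < m v - c"
  then have "y + c < m v" using c by (simp add: less_diff_eq_ennreal)
  then have "eventually (\<lambda>w. y + c < m w) (at v)"
    using lsc unfolding lsc_ennreal_def le_Liminf_iff by blast
  then show "eventually (\<lambda>w. y < m w - c) (at v)"
    by (rule eventually_mono) (use c in \<open>simp add: less_diff_eq_ennreal\<close>)
qed

text \<open>
  If \<open>\<xi> \<le> m\<close> with equality at some point, then in \<open>m = (m - m 0) + m 0\<close> the second term is the value
  at \<open>\<xi>\<close> of the dual of the first.
\<close>

lemma dual_minus_min_of_tight:
  assumes ge: "\<And>v. ereal (blinfun_apply \<xi> v) \<le> enn2ereal (m v)" and min: "\<And>v. m 0 \<le> m v"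
    and p: "enn2ereal (m p) = ereal (blinfun_apply \<xi> p)"
  shows "dual (\<lambda>v. m v - m 0) \<xi> = m 0"
proof -
  obtain a where a: "m p = ennreal a" "a \<ge> 0"
    using p by (cases "m p") auto
  then obtain m0 where m0: "m 0 = ennreal m0" "m0 \<ge> 0"
    using min[of p] by (cases "m 0") (auto simp: top_unique)
  have m0_le: "m0 \<le> b" if "m v = ennreal b" "b \<ge> 0" for v b
    using min[of v] that m0 by simp
  have "(SUP v. ereal (blinfun_apply \<xi> v) - enn2ereal (m v - m 0)) = ereal m0"
  proof (rule SUP_eqI)
    fix v
    show "ereal (blinfun_apply \<xi> v) - enn2ereal (m v - m 0) \<le> ereal m0"
    proof (cases "m v")
      case (real b)
      then show ?thesis
        using ge[of v] m0 m0_le[of v b] by (simp add: ennreal_minus)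
    next
      case top
      then show ?thesis using m0 by simp
    qed
  next
    fix y
    assume "\<And>v. v \<in> UNIV \<Longrightarrow> ereal (blinfun_apply \<xi> v) - enn2ereal (m v - m 0) \<le> y"
    from this[of p] show "ereal m0 \<le> y"
      using a m0 p m0_le[of p a] by (simp add: ennreal_minus)
  qed
  then show ?thesis
    unfolding dual_def using m0 by simp
qed

section \<open>Uniqueness of Gamma-limits\<close>

lemma Gamma_limit_le:
  assumes "Gamma_converges X \<Phi> \<Phi>1" "Gamma_converges X \<Phi> \<Phi>2" "x \<in> topspace X"
  shows "\<Phi>1 x \<le> \<Phi>2 x"
proof -
  obtain y where y: "limitin X y x (at_right 0)" "Limsup (at_right 0) (\<lambda>\<epsilon>. \<Phi> \<epsilon> (y \<epsilon>)) \<le> \<Phi>2 x"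
    using assms unfolding Gamma_converges_def by blast
  have "\<Phi>1 x \<le> Liminf (at_right 0) (\<lambda>\<epsilon>. \<Phi> \<epsilon> (y \<epsilon>))"
    using assms(1,3) y(1) unfolding Gamma_converges_def by blast
  also have "\<dots> \<le> Limsup (at_right 0) (\<lambda>\<epsilon>. \<Phi> \<epsilon> (y \<epsilon>))"
    by (rule Liminf_le_Limsup) simp
  finally show ?thesis using y(2) by simp
qed

lemma Gamma_limit_unique:
  assumes "Gamma_converges X \<Phi> \<Phi>1" "Gamma_converges X \<Phi> \<Phi>2" "x \<in> topspace X"
  shows "\<Phi>1 x = \<Phi>2 x"
  using Gamma_limit_le[OF assms] Gamma_limit_le[OF assms(2,1,3)] by simp

lemma topspace_curve_topology: "topspace (curve_topology T) = {u. continuous_on {0..T} u}"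
proof -
  have "UNIV \<in> {{u::real \<Rightarrow> 'a. u ` K \<subseteq> U} | K U. compact K \<and> K \<subseteq> {0..T} \<and> open U}"
    by (intro CollectI exI[of _ "{}"] exI[of _ UNIV]) simp
  then have "\<Union>{{u::real \<Rightarrow> 'a. u ` K \<subseteq> U} | K U. compact K \<and> K \<subseteq> {0..T} \<and> open U} = UNIV"
    by (meson Union_upper top.extremum_uniqueI)
  then show ?thesis
    unfolding curve_topology_def topspace_subtopology topology_generated_by_topspace by simp
qed

section \<open>The untilted limit functional\<close>

lemma C1_function_const: "C1_function A (\<lambda>_. a)"
proof -
  have "(\<lambda>_. a) \<circ> h = (\<lambda>_. a)" for h :: "'b \<Rightarrow> 'a"
    by (simp add: comp_def)
  then show ?thesis
    by (simp add: C1_function_def)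
qed

lemma differential_const: "differential A (\<lambda>_. a) q = 0"
proof -
  have "Blinfun (\<lambda>_. 0 :: real) = (0 :: 'a \<Rightarrow>\<^sub>L real)"
    by (simp add: zero_blinfun_def)
  then show ?thesis
    by (simp add: differential_def Let_def comp_def)
qed

lemma untilted_Gamma_limit:
  fixes A :: "('q::topological_space, 'm::real_normed_vector) chart set"
  assumes basic: "basic_assumptions A E R E0 N0" and T: "T > 0"
    and N0: "\<And>q v. N0 q v 0 = R0 q v + dual (R0 q) (- differential A E0 q)"
  shows "Gamma_converges (curve_topology T) (\<lambda>\<epsilon>. diss_functional A T (E \<epsilon>) (R \<epsilon>) (\<lambda>_. 0))
           (diss_functional A T E0 R0 (\<lambda>_. 0))"
proof -
  obtain D0 :: "real \<Rightarrow> (real \<Rightarrow> 'q) \<Rightarrow> ('q \<Rightarrow> real) \<Rightarrow> ennreal" where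
    D0: "\<forall>T>0. \<forall>F. C1_function A F \<longrightarrow>
        Gamma_converges (curve_topology T) (\<lambda>\<epsilon>. diss_functional A T (E \<epsilon>) (R \<epsilon>) F)
          (\<lambda>u. if AC_curve A T u then D0 T u F else \<infinity>)"
      "\<forall>T>0. \<forall>F u. C1_function A F \<and> AC_curve A T u \<longrightarrow>
        D0 T u F = AC_integral A T (\<lambda>q v. N0 q v (- differential A F q)) u"
    using basic unfolding basic_assumptions_def by (elim conjE exE) (rule that)
  have G: "Gamma_converges (curve_topology T) (\<lambda>\<epsilon>. diss_functional A T (E \<epsilon>) (R \<epsilon>) (\<lambda>_. 0))
      (\<lambda>u. if AC_curve A T u then D0 T u (\<lambda>_. 0) else \<infinity>)"
    using D0(1) T C1_function_const[of A 0] by simp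
  have D: "D0 T u (\<lambda>_. 0) = AC_integral A T (\<lambda>q v. N0 q v 0) u" if "AC_curve A T u" for u
    using D0(2) T C1_function_const[of A 0] that by (simp add: differential_const)
  have "(\<lambda>u. if AC_curve A T u then D0 T u (\<lambda>_. 0) else \<infinity>) = diss_functional A T E0 R0 (\<lambda>_. 0)"
    using D by (simp add: fun_eq_iff diss_functional_def AC_integral_def differential_const N0)
  with G show ?thesis
    by simp
qed

lemma simple_EDP_if_split:
  fixes A :: "('q::topological_space, 'm::real_normed_vector) chart set"
  assumes "basic_assumptions A E R E0 N0" "gradient_system A E0 R0"
    and "\<And>q v. N0 q v 0 = R0 q v + dual (R0 q) (- differential A E0 q)"
  shows "simple_EDP A E R E0 R0"
  using assms untilted_Gamma_limit[OF assms(1) _ assms(3)]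
  unfolding simple_EDP_def basic_assumptions_def by simp

lemma diss_functional_eq_integral:
  assumes "AC_curve A T u"
  shows "diss_functional A T E R (\<lambda>_. 0) u = (\<integral>\<^sup>+ t\<in>{0..T}. diss_along A T E R u t \<partial>lebesgue)"
  using assms by (simp add: diss_functional_def AC_integral_def diss_along_def differential_const)

section \<open>Localisation of the limit functional along curves\<close>

lemma AC_curve_restrict:
  assumes "AC_curve A T u" "s \<le> T"
  shows "AC_curve A s u"
  using assms unfolding AC_curve_def
  by (auto intro: continuous_on_subset)

lemma velocity_restrict:
  assumes "t < s" "s \<le> T"
  shows "velocity A s u t = velocity A T u t"
proof -
  have "at t within {0..s} = at t within {0..T}"
    by (rule at_within_nhd[of t "{..<s}"]) (use assms in auto)
  then show ?thesis
    by (simp add: velocity_def)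
qed

lemma diss_functional_restrict:
  assumes "AC_curve A T u" "s \<le> T"
  shows "diss_functional A s E R (\<lambda>_. 0) u = (\<integral>\<^sup>+ t\<in>{0..s}. diss_along A T E R u t \<partial>lebesgue)"
proof -
  have "AE t in lebesgue. t \<noteq> s"
    by (intro AE_completion AE_lborel_singleton)
  then have "(\<integral>\<^sup>+ t\<in>{0..s}. diss_along A s E R u t \<partial>lebesgue) =
      (\<integral>\<^sup>+ t\<in>{0..s}. diss_along A T E R u t \<partial>lebesgue)"
  proof (intro nn_integral_cong_AE, eventually_elim)
    case (elim t)
    then show ?case
      using velocity_restrict[of t s T A u] assms(2)
      by (auto simp: diss_along_def indicator_def)
  qed
  then show ?thesis
    using diss_functional_eq_integral[OF AC_curve_restrict[OF assms]] by simp
qed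

lemma AC_curve_const: "AC_curve A T (\<lambda>_. q)"
  by (auto simp: AC_curve_def abs_continuous_on_def intro!: exI[of _ 1])

lemma velocity_const:
  assumes "T > 0" "t \<in> {0..T}"
  shows "velocity A T (\<lambda>_. q) t = 0"
proof -
  have "((\<lambda>_. chart_map (chart_at A q) q) has_vector_derivative 0) (at t within {0..T})"
    by (rule has_vector_derivative_const)
  moreover have "at t within {0..T} \<noteq> bot"
    using assms by (simp add: trivial_limit_within islimpt_Icc)
  ultimately show ?thesis
    unfolding velocity_def comp_def by (simp add: vector_derivative_within)
qed

lemma diss_functional_const:
  assumes "T > 0" "R q 0 = 0"
  shows "diss_functional A T E R (\<lambda>_. 0) (\<lambda>_. q) = dual (R q) (- differential A E q) * ennreal T"
proof -
  have "diss_functional A T E R (\<lambda>_. 0) (\<lambda>_. q) =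
      (\<integral>\<^sup>+ t. dual (R q) (- differential A E q) * indicator {0..T} t \<partial>lebesgue)"
    unfolding diss_functional_eq_integral[OF AC_curve_const]
    using assms by (intro nn_integral_cong) (auto simp: diss_along_def velocity_const indicator_def)
  also have "\<dots> = dual (R q) (- differential A E q) * ennreal T"
    using assms by (subst nn_integral_cmult_indicator) auto
  finally show ?thesis .
qed

text \<open>
  Borel representatives of \<open>f\<close> and \<open>g\<close> are densities of finite Borel measures that agree on all
  half-lines, hence of the same measure.
\<close>

lemma AE_eq_if_initial_integrals_eq:
  fixes f g :: "real \<Rightarrow> ennreal"
  assumes f: "f \<in> borel_measurable lebesgue" and g: "g \<in> borel_measurable lebesgue"
    and fin: "integral\<^sup>N lebesgue f < \<infinity>" and total: "integral\<^sup>N lebesgue f = integral\<^sup>N lebesgue g"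
    and init: "\<And>s. (\<integral>\<^sup>+ t\<in>{..s}. f t \<partial>lebesgue) = (\<integral>\<^sup>+ t\<in>{..s}. g t \<partial>lebesgue)"
  shows "AE t in lebesgue. f t = g t"
proof -
  obtain f' where f': "f' \<in> borel_measurable lborel" "AE t in lborel. f t = f' t"
    using completion_ex_borel_measurable[OF f] by blast
  obtain g' where g': "g' \<in> borel_measurable lborel" "AE t in lborel. g t = g' t"
    using completion_ex_borel_measurable[OF g] by blast
  have int: "(\<integral>\<^sup>+ t\<in>S. h' t \<partial>lborel) = (\<integral>\<^sup>+ t\<in>S. h t \<partial>lebesgue)"
    if "AE t in lborel. h t = h' t" for h h' :: "real \<Rightarrow> ennreal" and S
    unfolding nn_integral_completion
    by (rule nn_integral_cong_AE) (use that in \<open>eventually_elim, simp\<close>)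
  have tail: "emeasure (density lborel h') {s<..} =
      integral\<^sup>N lebesgue h - (\<integral>\<^sup>+ t\<in>{..s}. h t \<partial>lebesgue)"
    if h: "h' \<in> borel_measurable lborel" "AE t in lborel. h t = h' t" "integral\<^sup>N lebesgue h < \<infinity>"
    for h h' :: "real \<Rightarrow> ennreal" and s
  proof -
    have "integral\<^sup>N lebesgue h = (\<integral>\<^sup>+ t. h' t * indicator {..s} t + h' t * indicator {s<..} t \<partial>lborel)"
    proof -
      have "h' t = h' t * indicator {..s} t + h' t * indicator {s<..} t" for t
        by (cases "t \<le> s") simp_all
      then show ?thesis
        using int[OF h(2), of UNIV] by simp
    qed
    also have "\<dots> = (\<integral>\<^sup>+ t\<in>{..s}. h' t \<partial>lborel) + (\<integral>\<^sup>+ t\<in>{s<..}. h' t \<partial>lborel)"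
      using h(1) by (intro nn_integral_add) auto
    also have "(\<integral>\<^sup>+ t\<in>{s<..}. h' t \<partial>lborel) = emeasure (density lborel h') {s<..}"
      using h(1) by (simp add: emeasure_density)
    finally have *: "integral\<^sup>N lebesgue h =
        (\<integral>\<^sup>+ t\<in>{..s}. h t \<partial>lebesgue) + emeasure (density lborel h') {s<..}"
      using int[OF h(2), of "{..s}"] by simp
    with h(3) have "(\<integral>\<^sup>+ t\<in>{..s}. h t \<partial>lebesgue) \<noteq> top"
      by auto
    then show ?thesis
      unfolding * by simp
  qed
  have "density lborel f' = density lborel g'"
  proof (rule measure_eqI_lessThan)
    fix s
    show "emeasure (density lborel f') {s<..} = emeasure (density lborel g') {s<..}"
      using tail[OF f' fin] tail[OF g'] fin total init by simp
    show "emeasure (density lborel f') {s<..} < \<infinity>"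
      unfolding tail[OF f' fin] using fin by (simp add: diff_less_top_ennreal)
  qed simp_all
  then have "AE t in lborel. f' t = g' t"
    using sigma_finite_measure.density_unique_iff[OF lborel.sigma_finite_measure_axioms f'(1) g'(1)] by simp
  with f'(2) g'(2) have "AE t in lborel. f t = g t"
    by eventually_elim simp
  then show ?thesis
    by (rule AE_completion)
qed

section \<open>Simple EDP limits\<close>

lemma simple_EDP_potentialD:
  assumes "simple_EDP A E R E0 R0"
  shows "R0 q 0 = 0"
  using assms unfolding simple_EDP_def gradient_system_def dissipation_potential_def by simp

lemma simple_EDP_limit_functional_unique:
  assumes "simple_EDP A E R E0 R1" "simple_EDP A E R E0 R2" "T > 0" "AC_curve A T u"
  shows "diss_functional A T E0 R1 (\<lambda>_. 0) u = diss_functional A T E0 R2 (\<lambda>_. 0) u"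
proof -
  have "u \<in> topspace (curve_topology T)"
    using assms(4) by (simp add: topspace_curve_topology AC_curve_def)
  moreover have G: "Gamma_converges (curve_topology T) (\<lambda>\<epsilon>. diss_functional A T (E \<epsilon>) (R \<epsilon>) (\<lambda>_. 0))
      (diss_functional A T E0 i (\<lambda>_. 0))" if "simple_EDP A E R E0 i" for i
    using that assms(3) unfolding simple_EDP_def by simp
  ultimately show ?thesis
    using Gamma_limit_unique[OF G[OF assms(1)] G[OF assms(2)]] by simp
qed

text \<open>
  Along a constant curve the velocity is 0, where potentials vanish, and only the dual term is left.
\<close>

lemma simple_EDP_dual_unique:
  assumes "simple_EDP A E R E0 R1" "simple_EDP A E R E0 R2"
  shows "dual (R1 q) (- differential A E0 q) = dual (R2 q) (- differential A E0 q)"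
  using simple_EDP_limit_functional_unique[OF assms zero_less_one AC_curve_const[of A 1 q]]
    simple_EDP_potentialD[OF assms(1)] simple_EDP_potentialD[OF assms(2)]
  by (simp add: diss_functional_const)

text \<open>
  Since both limit functionals agree on all initial intervals, their integrands along a curve agree
  almost everywhere; the common, almost everywhere finite dual term then cancels.
\<close>

lemma simple_EDP_agree_along_curves:
  assumes simple: "simple_EDP A E R E0 R1" "simple_EDP A E R E0 R2"
  shows "agree_along_curves A E0 R1 R2"
  unfolding agree_along_curves_def
proof (intro allI impI, elim conjE)
  fix T :: real and u
  assume T: "0 < T" and AC: "AC_curve A T u"
    and meas: "diss_along A T E0 R1 u \<in> borel_measurable (lebesgue_on {0..T})"
      "diss_along A T E0 R2 u \<in> borel_measurable (lebesgue_on {0..T})"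
    and fin: "diss_functional A T E0 R2 (\<lambda>_. 0) u < \<infinity>"
  define f where "f i t = diss_along A T E0 i u t * indicator {0..T} t" for i t
  have meas_f: "f R1 \<in> borel_measurable lebesgue" "f R2 \<in> borel_measurable lebesgue"
    using meas unfolding f_def by (simp_all add: borel_measurable_restrict_space_iff_ennreal)
  have total: "integral\<^sup>N lebesgue (f i) = diss_functional A T E0 i (\<lambda>_. 0) u" for i
    unfolding f_def diss_functional_eq_integral[OF AC] ..
  have init: "(\<integral>\<^sup>+ t\<in>{..s}. f R1 t \<partial>lebesgue) = (\<integral>\<^sup>+ t\<in>{..s}. f R2 t \<partial>lebesgue)" for s
  proof -
    have cut: "f i t * indicator {..s} t = diss_along A T E0 i u t * indicator {0..min s T} t" for i t
      by (auto simp: f_def indicator_def)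
    \<comment> \<open>A curve restricted to an initial interval is again an admissible curve.\<close>
    show ?thesis
    proof (cases "0 < min s T")
      case True
      have "(\<integral>\<^sup>+ t\<in>{..s}. f i t \<partial>lebesgue) = diss_functional A (min s T) E0 i (\<lambda>_. 0) u" for i
        unfolding cut by (rule diss_functional_restrict[OF AC, symmetric]) simp
      then show ?thesis
        using simple_EDP_limit_functional_unique[OF simple True AC_curve_restrict[OF AC]] by simp
    next
      case False
      have "AE t in lebesgue. t \<noteq> (0::real)"
        by (intro AE_completion AE_lborel_singleton)
      then show ?thesis
        unfolding cut
        by (intro nn_integral_cong_AE, eventually_elim) (use False in \<open>auto simp: indicator_def\<close>)
    qed
  qed
  have tot_eq: "integral\<^sup>N lebesgue (f R2) = integral\<^sup>N lebesgue (f R1)"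
    unfolding total using simple_EDP_limit_functional_unique[OF simple T AC] by simp
  have fin2: "integral\<^sup>N lebesgue (f R2) < \<infinity>"
    unfolding total by (rule fin)
  have "AE t in lebesgue. f R2 t = f R1 t"
    using AE_eq_if_initial_integrals_eq[OF meas_f(2,1) fin2 tot_eq] init by simp
  moreover have "AE t in lebesgue. f R2 t \<noteq> \<infinity>"
    using nn_integral_PInf_AE[OF meas_f(2)] fin2 by simp
  ultimately have "AE t in lebesgue. t \<in> {0..T} \<longrightarrow>
      R1 (u t) (velocity A T u t) = R2 (u t) (velocity A T u t)"
  proof eventually_elim
    case (elim t)
    show ?case
    proof
      assume t: "t \<in> {0..T}"
      let ?d = "dual (R2 (u t)) (- differential A E0 (u t))"
      have "R2 (u t) (velocity A T u t) + ?d = R1 (u t) (velocity A T u t) + ?d"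
        and "R2 (u t) (velocity A T u t) + ?d \<noteq> \<infinity>"
        using elim t by (simp_all add: f_def diss_along_def simple_EDP_dual_unique[OF simple])
      then show "R1 (u t) (velocity A T u t) = R2 (u t) (velocity A T u t)"
        by (metis ennreal_add_diff_cancel_right ennreal_add_eq_top infinity_ennreal_def)
    qed
  qed
  then show "AE t in lebesgue_on {0..T}.
      R1 (u t) (velocity A T u t) = R2 (u t) (velocity A T u t)"
    by (simp add: AE_restrict_space_iff)
qed

section \<open>Relations between the notions of convergence\<close>

lemma tilt_EDP_N0:
  assumes "tilt_EDP A E R E0 N0 Rhat"
  shows "N0 q v 0 = Rhat q v + dual (Rhat q) (- differential A E0 q)"
proof -
  have "M0 A E0 N0 q v (- differential A E0 q) = Rhat q v + dual (Rhat q) (- differential A E0 q)"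
    using assms unfolding tilt_EDP_def by blast
  then show ?thesis by (simp add: M0_def)
qed

lemma tilt_EDP_imp_contact_EDP:
  assumes tilt: "tilt_EDP A E R E0 N0 Rhat"
  shows "contact_EDP A E R E0 N0 Rhat"
proof -
  have zero: "Rhat q 0 = 0" for q
    using tilt unfolding tilt_EDP_def gradient_system_def dissipation_potential_def by blast
  have M: "M0 A E0 N0 q v \<xi> = Rhat q v + dual (Rhat q) \<xi>" for q v \<xi>
    using tilt unfolding tilt_EDP_def by blast
  show ?thesis
    using tilt unfolding tilt_EDP_def contact_EDP_def
    by (simp add: M Fenchel_Young_equality_iff[of "Rhat _", OF zero])
qed

lemma tilt_EDP_imp_simple_EDP:
  assumes tilt: "tilt_EDP A E R E0 N0 Rhat"
  shows "simple_EDP A E R E0 Rhat"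
proof (rule simple_EDP_if_split)
  show "basic_assumptions A E R E0 N0" "gradient_system A E0 Rhat"
    using tilt by (simp_all add: tilt_EDP_def)
  show "N0 q v 0 = Rhat q v + dual (Rhat q) (- differential A E0 q)" for q v
    by (rule tilt_EDP_N0[OF tilt])
qed

lemma contact_EDP_potential_unique:
  fixes A :: "('q::topological_space, 'm::{real_inner, heine_borel}) chart set"
  assumes "contact_EDP A E R E0 N0 R1" "contact_EDP A E R E0 N0 R2"
  shows "R1 = R2"
proof
  fix q
  have "{(v, \<xi>). \<xi> \<in> subdifferential (R1 q) v} = {(v, \<xi>). \<xi> \<in> subdifferential (R2 q) v}"
    using assms unfolding contact_EDP_def by simp
  then have "subdifferential (R1 q) v = subdifferential (R2 q) v" for v
    by (auto simp: set_eq_iff)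
  moreover have "dissipation_potential R1" "dissipation_potential R2"
    using assms by (simp_all add: contact_EDP_def gradient_system_def)
  ultimately show "R1 q = R2 q"
    unfolding dissipation_potential_def by (intro eq_if_subdifferential_eq) auto
qed

lemma superlinear_potential_exists_subgradient:
  fixes A :: "('q::{t2_space, second_countable_topology}, 'm::{real_inner, heine_borel}) chart set"
  assumes "riemannian_manifold A g" "dissipation_potential P" "superlinear (riem_norm g q) (P q)"
  obtains p where "\<xi> \<in> subdifferential (P q) p"
proof -
  have "bounded_bilinear (g q)" "\<And>v. v \<noteq> 0 \<Longrightarrow> 0 < g q v v"
    using assms(1) unfolding riemannian_manifold_def riemannian_metric_def by blast+
  then obtain c where c: "c > 0" "\<And>v. c * norm v \<le> riem_norm g q v"
    using positive_bilinear_norm_lower_bound[of "g q"] unfolding riem_norm_def by blast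
  have P: "lsc_ennreal (P q)" "P q 0 = 0"
    using assms(2) by (simp_all add: dissipation_potential_def)
  show ?thesis
    using superlinear_imp_exists_subgradient[where f="P q", OF assms(3) c P] that by blast
qed

text \<open>
  Only the values of \<open>M0\<close> at \<open>\<xi> = - DE0(q)\<close> enter the untilted functional. They are minimal at
  \<open>v = 0\<close>. Superlinearity yields a \<open>v\<close> with \<open>\<xi>\<close> in the subdifferential of \<open>Reff\<close> at \<open>v\<close>, hence a
  contact point, and so the minimal value is the dual of the remaining part at \<open>\<xi>\<close>.
\<close>

lemma superlinear_contact_EDP_imp_simple_EDP:
  fixes A :: "('q::{t2_space, second_countable_topology}, 'm::{real_inner, heine_borel}) chart set"
  assumes riem: "riemannian_manifold A g" and contact: "contact_EDP A E R E0 N0 Reff"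
    and sup: "\<And>q. superlinear (riem_norm g q) (Reff q)"
  shows "simple_EDP A E R E0 (\<lambda>q v. N0 q v 0 - N0 q 0 0)"
proof (rule simple_EDP_if_split)
  show basic: "basic_assumptions A E R E0 N0"
    using contact by (simp add: contact_EDP_def)
  have E0: "C1_function A E0" and pot: "dissipation_potential Reff"
    using contact by (simp_all add: contact_EDP_def gradient_system_def)
  define \<xi> where "\<xi> q = - differential A E0 q" for q
  have M: "M0 A E0 N0 q v (\<xi> q) = N0 q v 0" for q v
    by (simp add: M0_def \<xi>_def)
  have conv: "convex_ennreal (\<lambda>v. N0 q v 0)" and lsc: "lsc_ennreal (\<lambda>v. N0 q v 0)" for q
    using basic unfolding basic_assumptions_def by simp_all
  have ge: "ereal (blinfun_apply (\<xi> q) v) \<le> enn2ereal (N0 q v 0)"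
    and min: "N0 q 0 0 \<le> N0 q v 0" for q v
    using basic unfolding basic_assumptions_def M[symmetric] by simp_all
  have ex: "\<exists>p. enn2ereal (N0 q p 0) = ereal (blinfun_apply (\<xi> q) p)" for q
  proof -
    obtain p where "\<xi> q \<in> subdifferential (Reff q) p"
      using superlinear_potential_exists_subgradient[OF riem pot sup] .
    then have "(p, \<xi> q) \<in> {(v, \<eta>). enn2ereal (M0 A E0 N0 q v \<eta>) = ereal (blinfun_apply \<eta> v)}"
      using contact by (simp add: contact_EDP_def)
    then show ?thesis
      by (auto simp: M)
  qed
  have fin: "N0 q 0 0 \<noteq> \<infinity>" for q
  proof
    assume top: "N0 q 0 0 = \<infinity>"
    obtain p where "enn2ereal (N0 q p 0) = ereal (blinfun_apply (\<xi> q) p)"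
      using ex by blast
    moreover have "N0 q p 0 = top"
      using min[of q p] top by (simp add: top_unique)
    ultimately show False by simp
  qed
  have "dissipation_potential (\<lambda>q v. N0 q v 0 - N0 q 0 0)"
    unfolding dissipation_potential_def
    using convex_ennreal_minus_min[of "\<lambda>v. N0 _ v 0", OF conv min fin]
      lsc_ennreal_minus_const[OF lsc fin] fin by simp
  with E0 show "gradient_system A E0 (\<lambda>q v. N0 q v 0 - N0 q 0 0)"
    by (simp add: gradient_system_def)
  fix q v
  obtain p where p: "enn2ereal (N0 q p 0) = ereal (blinfun_apply (\<xi> q) p)"
    using ex by blast
  have "dual (\<lambda>v. N0 q v 0 - N0 q 0 0) (\<xi> q) = N0 q 0 0"
    using dual_minus_min_of_tight[where m="\<lambda>v. N0 q v 0", OF ge min p] .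
  then show "N0 q v 0 = N0 q v 0 - N0 q 0 0 + dual (\<lambda>v. N0 q v 0 - N0 q 0 0) (- differential A E0 q)"
    using min[of q v] by (simp add: \<xi>_def diff_add_cancel_ennreal)
qed

text \<open>
  If two potentials yield the same integrand, then \<open>v = 0\<close> shows that their dual terms agree;
  superlinearity makes these finite, so that they cancel for every \<open>v\<close>.
\<close>

lemma potential_unique_if_split_eq:
  fixes A :: "('q::{t2_space, second_countable_topology}, 'm::{real_inner, heine_borel}) chart set"
  assumes riem: "riemannian_manifold A g"
    and pot: "dissipation_potential R1" "dissipation_potential R2"
    and sup: "\<And>q. superlinear (riem_norm g q) (R2 q)"
    and eq: "\<And>q v. R1 q v + dual (R1 q) (\<xi> q) = R2 q v + dual (R2 q) (\<xi> q)"
  shows "R1 = R2"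
proof (intro ext)
  fix q v
  have zero: "R1 q 0 = 0" "R2 q 0 = 0"
    using pot by (simp_all add: dissipation_potential_def)
  obtain p where p: "\<xi> q \<in> subdifferential (R2 q) p"
    using superlinear_potential_exists_subgradient[OF riem pot(2) sup] .
  have "dual (R2 q) (\<xi> q) \<noteq> top"
    using dual_finite_if_subgradient[where f="R2 q", OF zero(2) p] by simp
  moreover have "dual (R1 q) (\<xi> q) = dual (R2 q) (\<xi> q)"
    using eq[of q 0] zero by simp
  ultimately show "R1 q v = R2 q v"
    using eq[of q v] by (metis ennreal_add_diff_cancel_right)
qed

theorem lemma2p18:
  fixes A :: "('q::{t2_space, second_countable_topology}, 'm::{real_inner, heine_borel}) chart set"
    and g :: "'q \<Rightarrow> 'm \<Rightarrow> 'm \<Rightarrow> real"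
    and E :: "real \<Rightarrow> 'q \<Rightarrow> real"
    and R :: "real \<Rightarrow> 'q \<Rightarrow> 'm \<Rightarrow> ennreal"
    and E0 :: "'q \<Rightarrow> real"
    and N0 :: "'q \<Rightarrow> 'm \<Rightarrow> ('m \<Rightarrow>\<^sub>L real) \<Rightarrow> ennreal"
  assumes "riemannian_manifold A g"
    and "\<And>\<epsilon>. \<epsilon> > 0 \<Longrightarrow> gradient_system A (E \<epsilon>) (R \<epsilon>)"
  shows
    "(\<forall>Rhat. tilt_EDP A E R E0 N0 Rhat \<longrightarrow> contact_EDP A E R E0 N0 Rhat) \<and>
     (\<forall>Reff. contact_EDP A E R E0 N0 Reff \<and> (\<forall>q. superlinear (riem_norm g q) (Reff q))
        \<longrightarrow> (\<exists>R0. simple_EDP A E R E0 R0)) \<and>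
     (\<forall>Rhat. tilt_EDP A E R E0 N0 Rhat \<longrightarrow>
        contact_EDP A E R E0 N0 Rhat \<and> simple_EDP A E R E0 Rhat \<and>
        (\<forall>Reff. contact_EDP A E R E0 N0 Reff \<longrightarrow> Reff = Rhat) \<and>
        (\<forall>R0. simple_EDP A E R E0 R0 \<longrightarrow> agree_along_curves A E0 R0 Rhat) \<and>
        (\<forall>R0. simple_EDP A E R E0 R0 \<and>
              (\<forall>q v. N0 q v 0 = R0 q v + dual (R0 q) (- differential A E0 q)) \<and>
              (\<forall>q. superlinear (riem_norm g q) (Rhat q))
           \<longrightarrow> R0 = Rhat))"
proof (intro conjI allI impI)
  show "contact_EDP A E R E0 N0 Rhat" if "tilt_EDP A E R E0 N0 Rhat" for Rhat
    by (rule tilt_EDP_imp_contact_EDP[OF that])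
  then show "contact_EDP A E R E0 N0 Rhat" if "tilt_EDP A E R E0 N0 Rhat" for Rhat
    using that .
  show "\<exists>R0. simple_EDP A E R E0 R0"
    if "contact_EDP A E R E0 N0 Reff \<and> (\<forall>q. superlinear (riem_norm g q) (Reff q))" for Reff
    using superlinear_contact_EDP_imp_simple_EDP[OF assms(1), of E R E0 N0 Reff] that by blast
next
  fix Rhat assume tilt: "tilt_EDP A E R E0 N0 Rhat"
  show simple: "simple_EDP A E R E0 Rhat"
    by (rule tilt_EDP_imp_simple_EDP[OF tilt])
  show "Reff = Rhat" if "contact_EDP A E R E0 N0 Reff" for Reff
    by (rule contact_EDP_potential_unique[OF that tilt_EDP_imp_contact_EDP[OF tilt]])
  show "agree_along_curves A E0 R0 Rhat" if "simple_EDP A E R E0 R0" for R0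
    by (rule simple_EDP_agree_along_curves[OF that simple])
  show "R0 = Rhat"
    if "simple_EDP A E R E0 R0 \<and>
        (\<forall>q v. N0 q v 0 = R0 q v + dual (R0 q) (- differential A E0 q)) \<and>
        (\<forall>q. superlinear (riem_norm g q) (Rhat q))" for R0
  proof (rule potential_unique_if_split_eq[OF assms(1)])
    show "dissipation_potential R0" "dissipation_potential Rhat"
      using that simple by (simp_all add: simple_EDP_def gradient_system_def)
    show "superlinear (riem_norm g q) (Rhat q)" for q
      using that by blast
    show "R0 q v + dual (R0 q) (- differential A E0 q) =
        Rhat q v + dual (Rhat q) (- differential A E0 q)" for q v
      using that tilt_EDP_N0[OF tilt, of q v] by simp
  qed
qed

end
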